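(* Let $k$ be a field, $S=k[x_1,\dots,x_n]$, let $I\subset(x_1,\dots,x_n)^2$ be a monomial ideal and $R=S/I$. Suppose that, with respect to some ordering $u_1,\dots,u_m$ of its minimal monomial generators: (1) $I$ has linear quotients and the ordering is degree increasing, i.e. $\deg u_1\le\dots\le\deg u_m$; (2) the decomposition function $g$ of $I$ is regular; (3) $I$ has nice Koszul lifts. For each $u\in G(I)$ choose an index $\ell=\ell(u)$ satisfying the nice Koszul lifts property for $u$. Then for every $i\ge1$, $H_i(K^R)$ has a $k$-basis consisting of the classes of the cycles $\overline{\left(\frac{u}{x_{\ell}}\right)}\,e_{\ell}\wedge e_\sigma$, where $u\in G(I)$, $\ell=\ell(u)$, and $\sigma\subset\operatorname{set}(u)$ with $|\sigma|=i-1$.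
   Context: $G(I)$ is the set of minimal monomial generators of $I$. $I$ has linear quotients with respect to an ordering $u_1,\dots,u_m$ of $G(I)$ if for all $j\ge2$ the colon ideal $(u_1,\dots,u_{j-1}):u_j$ is generated by a subset of $\{x_1,\dots,x_n\}$; then $\operatorname{set}(u_j)=\{i:x_i\in(u_1,\dots,u_{j-1}):u_j\}$ (so $\operatorname{set}(u_1)=\emptyset$). The decomposition function $g$ sends a monomial $w\in I$ to $g(w)=u_j$, where $j$ is the minimal index with $u_j\mid w$. It is regular if $\operatorname{set}(g(x_su))\subset\operatorname{set}(u)$ for all $u\in G(I)$ and all $s\in\operatorname{set}(u)$. $I$ has nice Koszul lifts if for each $u\in G(I)$ there is a fixed index $\ell\in\operatorname{supp}(u)=\{i:x_i\mid u\}$ such that $x_\ell$ divides $\frac{x_tu}{g(x_tu)}$ for all $t\in\operatorname{set}(u)$; such an $\ell$ is said to satisfy the nice Koszul lifts property for $u$. $K^R$ is the Koszul complex of $R$ with respect to $x_1,\dots,x_n$, i.e. the exterior algebra of $R^n$ (basis $e_1,\dots,e_n$) with $\partial(e_i)=\bar x_i$ extended as a derivation; $\bar f$ denotes the image of $f\in S$ in $R$; for $\sigma=\{\sigma_1<\dots<\sigma_p\}$, $e_\sigma=e_{\sigma_1}\wedge\dots\wedge e_{\sigma_p}$. *)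

theory Defs
  imports
    "HOL-Library.Poly_Mapping"
    "HOL-Algebra.Algebra"
    "HOL-Algebra.Algebraic_Closure_Type"
    "Jordan_Normal_Form.Missing_VectorSpace"
begin

section \<open>Polynomial rings and monomial ideals\<close>

text \<open>
  A monomial is identified with its exponent vector; the variables of the polynomial ring are
  indexed by an arbitrary finite linearly ordered type.
\<close>

type_synonym 'n mon = "'n \<Rightarrow>\<^sub>0 nat"
type_synonym ('n, 'k) mpoly = "'n mon \<Rightarrow>\<^sub>0 'k"

abbreviation field_ring :: "'k::field ring" where
  "field_ring \<equiv> ring_of_type_algebra"

abbreviation mpoly_ring :: "('n, 'k::field) mpoly ring" where
  "mpoly_ring \<equiv> ring_of_type_algebra"

definition xmon :: "'n mon \<Rightarrow> ('n, 'k::field) mpoly" where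
  "xmon u = Poly_Mapping.single u 1"

definition const :: "'k::field \<Rightarrow> ('n, 'k) mpoly" where
  "const c = Poly_Mapping.single 0 c"

abbreviation xvar :: "'n \<Rightarrow> 'n mon" where
  "xvar i \<equiv> Poly_Mapping.single i 1"

definition mdvd :: "'n mon \<Rightarrow> 'n mon \<Rightarrow> bool" where
  "mdvd u w \<longleftrightarrow> (\<exists>v. w = u + v)"

definition mdeg :: "'n::finite mon \<Rightarrow> nat" where
  "mdeg u = (\<Sum>i\<in>UNIV. Poly_Mapping.lookup u i)"

definition supp :: "'n mon \<Rightarrow> 'n set" where
  "supp u = {i. mdvd (xvar i) u}"

definition mon_gen :: "'n mon set \<Rightarrow> ('n, 'k::field) mpoly set" where
  "mon_gen U = Idl\<^bsub>mpoly_ring\<^esub> (xmon ` U)"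

definition monomial_ideal :: "('n, 'k::field) mpoly set \<Rightarrow> bool" where
  "monomial_ideal I \<longleftrightarrow> (\<exists>U. I = mon_gen U)"

definition max_ideal :: "('n, 'k::field) mpoly set" where
  "max_ideal = mon_gen (range xvar)"

definition minimal_monomial_generators :: "('n, 'k::field) mpoly set \<Rightarrow> 'n mon set \<Rightarrow> bool" where
  "minimal_monomial_generators I G \<longleftrightarrow>
     mon_gen G = I \<and> (\<forall>H. H \<subset> G \<longrightarrow> mon_gen H \<noteq> I)"

definition colon :: "('n, 'k::field) mpoly set \<Rightarrow> ('n, 'k) mpoly \<Rightarrow> ('n, 'k) mpoly set" where
  "colon J f = {h. h * f \<in> J}"


section \<open>Linear quotients, decomposition function and nice Koszul lifts\<close>

text \<open>
  In this section \<open>us = [u\<^sub>1, \<dots>, u\<^sub>m]\<close> is the ordered list of minimal monomial generators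
  (list positions start at 0).  The argument of type \<^typ>\<open>'k itself\<close> fixes the
  coefficient field in which the colon ideals are formed.
\<close>

definition linear_quotients :: "'k::field itself \<Rightarrow> 'n mon list \<Rightarrow> bool" where
  "linear_quotients _ us \<longleftrightarrow>
     (\<forall>j. 1 \<le> j \<and> j < length us \<longrightarrow>
        (\<exists>A. colon (mon_gen (set (take j us)) :: ('n, 'k) mpoly set) (xmon (us ! j))
             = mon_gen (xvar ` A)))"

definition lq_set :: "'k::field itself \<Rightarrow> 'n mon list \<Rightarrow> 'n mon \<Rightarrow> 'n set" where
  "lq_set _ us u =
     {s. \<exists>j < length us. us ! j = u \<and>
           xmon (xvar s) \<in> colon (mon_gen (set (take j us)) :: ('n, 'k) mpoly set) (xmon u)}"

definition decomp :: "'n mon list \<Rightarrow> 'n mon \<Rightarrow> 'n mon" where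
  "decomp us w = us ! (LEAST j. j < length us \<and> mdvd (us ! j) w)"

definition regular_decomp :: "'k::field itself \<Rightarrow> 'n mon list \<Rightarrow> bool" where
  "regular_decomp k us \<longleftrightarrow>
     (\<forall>u \<in> set us. \<forall>s \<in> lq_set k us u. lq_set k us (decomp us (xvar s + u)) \<subseteq> lq_set k us u)"

text \<open>
  The subtraction below is an exact quotient of monomials, since \<open>decomp us w\<close> divides \<open>w\<close>
  whenever \<open>w\<close> lies in the ideal.
\<close>

definition nice_lift_index :: "'k::field itself \<Rightarrow> 'n mon list \<Rightarrow> 'n mon \<Rightarrow> 'n \<Rightarrow> bool" where
  "nice_lift_index k us u l \<longleftrightarrow>
     l \<in> supp u \<and>
     (\<forall>t \<in> lq_set k us u. mdvd (xvar l) ((xvar t + u) - decomp us (xvar t + u)))"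

definition nice_koszul_lifts :: "'k::field itself \<Rightarrow> 'n mon list \<Rightarrow> bool" where
  "nice_koszul_lifts k us \<longleftrightarrow> (\<forall>u \<in> set us. \<exists>l. nice_lift_index k us u l)"


section \<open>The Koszul complex and its homology\<close>

text \<open>
  The exterior algebra of the free \<open>R\<close>-module with basis \<open>e\<^sub>i\<close> (\<open>i\<close> of type \<open>'n\<close>): an element is
  given by its coefficients with respect to the basis \<open>e\<^sub>\<sigma>\<close>, \<open>\<sigma>\<close> a set of indices.  The product
  is determined by \<open>e\<^sub>\<sigma> \<and> e\<^sub>\<tau> = (-1)\<^sup>N e\<^sub>\<sigma>\<^sub>\<union>\<^sub>\<tau>\<close> for disjoint \<open>\<sigma>\<close>, \<open>\<tau>\<close>, where \<open>N\<close> is the number of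
  pairs \<open>i \<in> \<sigma>\<close>, \<open>j \<in> \<tau>\<close> with \<open>j < i\<close>, and by \<open>e\<^sub>\<sigma> \<and> e\<^sub>\<tau> = 0\<close> otherwise.
\<close>

definition ext_sign :: "('r, 'm) ring_scheme \<Rightarrow> 'n::linorder set \<Rightarrow> 'n set \<Rightarrow> 'r" where
  "ext_sign R \<sigma> \<tau> = (\<ominus>\<^bsub>R\<^esub> \<one>\<^bsub>R\<^esub>) [^]\<^bsub>R\<^esub> card {(i, j). i \<in> \<sigma> \<and> j \<in> \<tau> \<and> j < i}"

definition ext_basis :: "('r, 'm) ring_scheme \<Rightarrow> 'n set \<Rightarrow> 'n set \<Rightarrow> 'r" where
  "ext_basis R \<sigma> = (\<lambda>\<rho>. if \<rho> = \<sigma> then \<one>\<^bsub>R\<^esub> else \<zero>\<^bsub>R\<^esub>)"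

definition exterior_algebra ::
    "('r, 'm) ring_scheme \<Rightarrow> ('r, 'n::{finite,linorder} set \<Rightarrow> 'r) module" where
  "exterior_algebra R =
     \<lparr>carrier = UNIV \<rightarrow> carrier R,
      monoid.mult = (\<lambda>a b \<rho>. \<Oplus>\<^bsub>R\<^esub>\<sigma>\<in>Pow \<rho>. ext_sign R \<sigma> (\<rho> - \<sigma>) \<otimes>\<^bsub>R\<^esub> (a \<sigma> \<otimes>\<^bsub>R\<^esub> b (\<rho> - \<sigma>))),
      one = ext_basis R {},
      ring.zero = (\<lambda>\<rho>. \<zero>\<^bsub>R\<^esub>),
      add = (\<lambda>a b \<rho>. a \<rho> \<oplus>\<^bsub>R\<^esub> b \<rho>),
      module.smult = (\<lambda>r a \<rho>. r \<otimes>\<^bsub>R\<^esub> a \<rho>)\<rparr>"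

text \<open>
  The \<open>R\<close>-linear derivation with \<open>\<partial>(e\<^sub>i) = x\<^sub>i\<close>; on the basis it is
  \<open>\<partial>(e\<^sub>\<sigma>) = \<Sum>\<^sub>i\<^sub>\<in>\<^sub>\<sigma> (-1)\<^sup>N x\<^sub>i e\<^sub>\<sigma>\<^sub>-\<^sub>i\<close> with \<open>N\<close> the number of elements of \<open>\<sigma>\<close> below \<open>i\<close>.
\<close>

definition koszul_diff ::
    "('r, 'm) ring_scheme \<Rightarrow> ('n::{finite,linorder} \<Rightarrow> 'r) \<Rightarrow> ('n set \<Rightarrow> 'r) \<Rightarrow> 'n set \<Rightarrow> 'r" where
  "koszul_diff R x a =
     (\<lambda>\<tau>. \<Oplus>\<^bsub>R\<^esub>i\<in>- \<tau>. ext_sign R {i} \<tau> \<otimes>\<^bsub>R\<^esub> (x i \<otimes>\<^bsub>R\<^esub> a (insert i \<tau>)))"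

lemma (in cring) ext_sign_closed:
  fixes \<sigma> \<tau> :: "'n::linorder set"
  shows "ext_sign R \<sigma> \<tau> \<in> carrier R"
  by (simp add: ext_sign_def)

lemma ext_sign_singleton:
  "ext_sign R {i} \<tau> = (\<ominus>\<^bsub>R\<^esub> \<one>\<^bsub>R\<^esub>) [^]\<^bsub>R\<^esub> card {j \<in> \<tau>. j < i}"
proof -
  have "{(i', j). i' \<in> {i} \<and> j \<in> \<tau> \<and> j < i'} = Pair i ` {j \<in> \<tau>. j < i}" by auto
  then show ?thesis by (simp add: ext_sign_def card_image inj_on_def)
qed

lemma (in cring) ext_basis_wedge:
  fixes i :: "'n::{finite,linorder}"
  assumes "a \<in> carrier (exterior_algebra R)"
  shows "(ext_basis R {i} \<otimes>\<^bsub>exterior_algebra R\<^esub> a) \<rho> =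
    (if i \<in> \<rho> then ext_sign R {i} (\<rho> - {i}) \<otimes> a (\<rho> - {i}) else \<zero>)"
proof -
  have a: "a s \<in> carrier R" for s using assms by (auto simp: exterior_algebra_def)
  let ?h = "\<lambda>\<sigma>. ext_sign R \<sigma> (\<rho> - \<sigma>) \<otimes> (ext_basis R {i} \<sigma> \<otimes> a (\<rho> - \<sigma>))"
  have "(\<Oplus>\<sigma>\<in>Pow \<rho>. ?h \<sigma>) = (\<Oplus>\<sigma>\<in>Pow \<rho> \<inter> {{i}}. ?h \<sigma>)"
    by (rule add.finprod_mono_neutral_cong_right) (auto simp: a ext_basis_def ext_sign_closed)
  also have "\<dots> = (if i \<in> \<rho> then ext_sign R {i} (\<rho> - {i}) \<otimes> a (\<rho> - {i}) else \<zero>)"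
    using a by (cases "i \<in> \<rho>") (auto simp: ext_sign_closed ext_basis_def)
  finally show ?thesis by (simp add: exterior_algebra_def)
qed

text \<open>Hence \<open>e\<^sub>\<sigma>\<close> is the increasing product of the \<open>e\<^sub>i\<close>, \<open>i \<in> \<sigma>\<close>.\<close>

lemma (in cring) ext_basis_insert:
  fixes i :: "'n::{finite,linorder}" and \<sigma> :: "'n set"
  assumes "\<And>j. j \<in> \<sigma> \<Longrightarrow> i < j"
  shows "ext_basis R {i} \<otimes>\<^bsub>exterior_algebra R\<^esub> ext_basis R \<sigma> = ext_basis R (insert i \<sigma>)"
proof
  fix \<rho>
  have c: "ext_basis R \<sigma> \<in> carrier (exterior_algebra R)"
    by (auto simp: exterior_algebra_def ext_basis_def)
  have i: "i \<notin> \<sigma>" using assms by blast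
  have e: "{j \<in> \<sigma>. j < i} = {}" using assms by force
  have 1: "ext_sign R {i} \<sigma> = \<one>" by (simp add: ext_sign_singleton e)
  show "(ext_basis R {i} \<otimes>\<^bsub>exterior_algebra R\<^esub> ext_basis R \<sigma>) \<rho> = ext_basis R (insert i \<sigma>) \<rho>"
  proof (cases "\<rho> = insert i \<sigma>")
    case True
    then have "\<rho> - {i} = \<sigma>" using i by auto
    then show ?thesis using True 1 by (simp add: ext_basis_wedge[OF c]) (simp add: ext_basis_def)
  next
    case False
    then have "i \<in> \<rho> \<Longrightarrow> \<rho> - {i} \<noteq> \<sigma>" by auto
    then show ?thesis using False
      by (simp add: ext_basis_wedge[OF c]) (simp add: ext_basis_def ext_sign_closed)
  qed
qed

text \<open>
  The following fact and \<open>koszul_diff_wedge\<close>, i.e.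
  \<open>\<partial>(e\<^sub>i \<and> a) = x\<^sub>i a - e\<^sub>i \<and> \<partial>a\<close>, say that \<open>\<partial>\<close> is the derivation extending \<open>e\<^sub>i \<mapsto> x\<^sub>i\<close>.
\<close>

lemma (in cring) koszul_diff_basis:
  fixes x :: "'n::{finite,linorder} \<Rightarrow> 'a"
  assumes "x \<in> UNIV \<rightarrow> carrier R"
  shows "koszul_diff R x (ext_basis R {i}) = x i \<odot>\<^bsub>exterior_algebra R\<^esub> \<one>\<^bsub>exterior_algebra R\<^esub>"
proof
  fix \<tau> :: "'n set"
  have x: "x j \<in> carrier R" for j using assms by auto
  let ?h = "\<lambda>j. ext_sign R {j} \<tau> \<otimes> (x j \<otimes> ext_basis R {i} (insert j \<tau>))"
  have "(\<Oplus>j\<in>-\<tau>. ?h j) = (\<Oplus>j\<in>(if \<tau> = {} then {i} else {}). ?h j)"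
    by (rule add.finprod_mono_neutral_cong_right) (auto simp: x ext_basis_def ext_sign_closed split: if_splits dest!: subset_singletonD)
  also have "\<dots> = x i \<otimes> ext_basis R {} \<tau>"
    using x by (auto simp: ext_basis_def ext_sign_singleton)
  finally show "koszul_diff R x (ext_basis R {i}) \<tau> =
      (x i \<odot>\<^bsub>exterior_algebra R\<^esub> \<one>\<^bsub>exterior_algebra R\<^esub>) \<tau>"
    by (simp add: koszul_diff_def exterior_algebra_def)
qed

lemma (in cring) ext_sign_square:
  fixes i :: "'n::linorder"
  shows "ext_sign R {i} \<tau> \<otimes> ext_sign R {i} \<tau> = \<one>"
proof -
  have "(\<ominus> \<one>) [^] n \<otimes> (\<ominus> \<one>) [^] n = \<one>" for n :: nat
    by (simp add: nat_pow_distrib[symmetric] l_minus r_minus)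
  then show ?thesis by (simp add: ext_sign_singleton)
qed

lemma (in cring) ext_sign_swap:
  fixes i j :: "'n::{finite,linorder}"
  assumes "i \<in> \<tau>" "j \<notin> \<tau>"
  shows "ext_sign R {j} \<tau> \<otimes> ext_sign R {i} (insert j \<tau> - {i}) =
    \<ominus> (ext_sign R {i} (\<tau> - {i}) \<otimes> ext_sign R {j} (\<tau> - {i}))"
proof -
  have ij: "i \<noteq> j" using assms by auto
  define N where "N \<rho> k = card {j \<in> \<rho>. j < k}" for \<rho> and k :: 'n
  have s: "ext_sign R {k} \<rho> = (\<ominus> \<one>) [^] N \<rho> k" for k \<rho>
    by (simp add: ext_sign_singleton N_def)
  have "Suc (N \<tau> j + N (insert j \<tau> - {i}) i) = N (\<tau> - {i}) i + N (\<tau> - {i}) j \<or>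
        N \<tau> j + N (insert j \<tau> - {i}) i = Suc (N (\<tau> - {i}) i + N (\<tau> - {i}) j)"
  proof (cases "i < j")
    case True
    then have "{k \<in> \<tau>. k < j} = insert i {k \<in> \<tau> - {i}. k < j}"
      "{k \<in> insert j \<tau> - {i}. k < i} = {k \<in> \<tau> - {i}. k < i}"
      using assms by auto
    then show ?thesis by (simp add: N_def)
  next
    case False
    then have "{k \<in> insert j \<tau> - {i}. k < i} = insert j {k \<in> \<tau> - {i}. k < i}"
      "{k \<in> \<tau>. k < j} = {k \<in> \<tau> - {i}. k < j}"
      using assms ij by auto
    then show ?thesis using assms by (simp add: N_def)
  qed
  then show ?thesis
    unfolding s nat_pow_mult[OF a_inv_closed[OF one_closed]]
    by (auto simp: r_minus) (metis a_inv_closed l_minus minus_minus nat_pow_Suc nat_pow_closed one_closed r_minus r_one)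
qed

lemma (in cring) koszul_diff_wedge:
  fixes x :: "'n::{finite,linorder} \<Rightarrow> 'a"
  assumes "x \<in> UNIV \<rightarrow> carrier R" and "a \<in> carrier (exterior_algebra R)"
  shows "koszul_diff R x (ext_basis R {i} \<otimes>\<^bsub>exterior_algebra R\<^esub> a) =
    (\<lambda>\<tau>. x i \<otimes> a \<tau> \<ominus> (ext_basis R {i} \<otimes>\<^bsub>exterior_algebra R\<^esub> koszul_diff R x a) \<tau>)"
proof
  fix \<tau> :: "'n set"
  have x: "x j \<in> carrier R" for j using assms by auto
  have a: "a s \<in> carrier R" for s using assms by (auto simp: exterior_algebra_def)
  have d: "koszul_diff R x a \<in> carrier (exterior_algebra R)"
    by (auto simp: koszul_diff_def exterior_algebra_def intro!: finsum_closed ext_sign_closed x a m_closed)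
  let ?w = "ext_basis R {i} \<otimes>\<^bsub>exterior_algebra R\<^esub> a"
  have w: "?w \<rho> = (if i \<in> \<rho> then ext_sign R {i} (\<rho> - {i}) \<otimes> a (\<rho> - {i}) else \<zero>)" for \<rho>
    by (rule ext_basis_wedge[OF assms(2)])
  have wc: "?w \<rho> \<in> carrier R" for \<rho> by (simp add: w a ext_sign_closed)
  note cl = x a wc ext_sign_closed
  show "koszul_diff R x ?w \<tau> = x i \<otimes> a \<tau> \<ominus> (ext_basis R {i} \<otimes>\<^bsub>exterior_algebra R\<^esub> koszul_diff R x a) \<tau>"
  proof (cases "i \<in> \<tau>")
    case False
    have "koszul_diff R x ?w \<tau> = (\<Oplus>j\<in>{i}. ext_sign R {j} \<tau> \<otimes> (x j \<otimes> ?w (insert j \<tau>)))"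
      unfolding koszul_diff_def using False
      by (intro add.finprod_mono_neutral_cong_right) (auto simp: cl w)
    also have "\<dots> = ext_sign R {i} \<tau> \<otimes> (x i \<otimes> (ext_sign R {i} \<tau> \<otimes> a \<tau>))"
      using False by (simp add: cl w)
    also have "\<dots> = (ext_sign R {i} \<tau> \<otimes> ext_sign R {i} \<tau>) \<otimes> (x i \<otimes> a \<tau>)"
      by (simp add: cl m_ac)
    finally show ?thesis using False
      by (simp add: ext_basis_wedge[OF d] ext_sign_square cl minus_eq)
  next
    case True
    let ?t = "\<tau> - {i}" and ?s = "ext_sign R {i} (\<tau> - {i})"
    let ?f = "\<lambda>j. ext_sign R {j} ?t \<otimes> (x j \<otimes> a (insert j ?t))"
    have "koszul_diff R x ?w \<tau> = (\<Oplus>j\<in>-\<tau>. (\<ominus> ?s) \<otimes> ?f j)"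
      unfolding koszul_diff_def
    proof (rule add.finprod_cong')
      fix j assume j: "j \<in> - \<tau>"
      have e: "insert j \<tau> - {i} = insert j ?t" using True j by auto
      have "ext_sign R {j} \<tau> \<otimes> (x j \<otimes> ?w (insert j \<tau>)) =
        (ext_sign R {j} \<tau> \<otimes> ext_sign R {i} (insert j \<tau> - {i})) \<otimes> (x j \<otimes> a (insert j ?t))"
        using True by (simp add: w e cl m_ac)
      also have "\<dots> = (\<ominus> ?s) \<otimes> ?f j"
        using True j by (simp add: ext_sign_swap cl m_assoc l_minus)
      finally show "ext_sign R {j} \<tau> \<otimes> (x j \<otimes> ?w (insert j \<tau>)) = (\<ominus> ?s) \<otimes> ?f j" .
    qed (auto simp: cl)
    also have "\<dots> = (\<ominus> ?s) \<otimes> (\<Oplus>j\<in>-\<tau>. ?f j)"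
      by (rule finsum_rdistr[symmetric]) (auto simp: cl)
    finally have L: "koszul_diff R x ?w \<tau> = \<ominus> (?s \<otimes> (\<Oplus>j\<in>-\<tau>. ?f j))"
      by (simp add: l_minus cl Pi_def)
    have i: "insert i ?t = \<tau>" "- ?t = insert i (- \<tau>)" using True by auto
    have "koszul_diff R x a ?t = ?f i \<oplus> (\<Oplus>j\<in>-\<tau>. ?f j)"
      unfolding koszul_diff_def i(2) using True by (subst finsum_insert) (auto simp: cl)
    then have "?s \<otimes> koszul_diff R x a ?t = (?s \<otimes> ?s) \<otimes> (x i \<otimes> a \<tau>) \<oplus> ?s \<otimes> (\<Oplus>j\<in>-\<tau>. ?f j)"
      using True by (simp add: i(1) r_distr cl Pi_def m_assoc insert_absorb)
    then show ?thesis
      using True by (simp add: L ext_basis_wedge[OF d] ext_sign_square cl Pi_def minus_eq minus_add a_assoc[symmetric] r_neg)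
  qed
qed

definition koszul_chains ::
    "('r, 'm) ring_scheme \<Rightarrow> nat \<Rightarrow> ('n::{finite,linorder} set \<Rightarrow> 'r) set" where
  "koszul_chains R i =
     {a \<in> carrier (exterior_algebra R). \<forall>\<sigma>. card \<sigma> \<noteq> i \<longrightarrow> a \<sigma> = \<zero>\<^bsub>R\<^esub>}"

definition koszul_cycles ::
    "('r, 'm) ring_scheme \<Rightarrow> ('n::{finite,linorder} \<Rightarrow> 'r) \<Rightarrow> nat \<Rightarrow> ('n set \<Rightarrow> 'r) set" where
  "koszul_cycles R x i =
     {a \<in> koszul_chains R i. koszul_diff R x a = \<zero>\<^bsub>exterior_algebra R\<^esub>}"

definition koszul_boundaries ::
    "('r, 'm) ring_scheme \<Rightarrow> ('n::{finite,linorder} \<Rightarrow> 'r) \<Rightarrow> nat \<Rightarrow> ('n set \<Rightarrow> 'r) set" where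
  "koszul_boundaries R x i = koszul_diff R x ` koszul_chains R (Suc i)"

definition koszul_class ::
    "('r, 'm) ring_scheme \<Rightarrow> ('n::{finite,linorder} \<Rightarrow> 'r) \<Rightarrow> nat \<Rightarrow> ('n set \<Rightarrow> 'r) \<Rightarrow> ('n set \<Rightarrow> 'r) set"
  where "koszul_class R x i z = koszul_boundaries R x i +>\<^bsub>exterior_algebra R\<^esub> z"

text \<open>
  Cycles modulo boundaries, as a vector space over \<open>k\<close> acting through the structure map
  \<open>\<phi> : k \<rightarrow> R\<close>.  The record fields \<open>mult\<close> and \<open>one\<close> play no role for a module.
\<close>

definition koszul_homology ::
    "('r, 'm) ring_scheme \<Rightarrow> ('k \<Rightarrow> 'r) \<Rightarrow> ('n::{finite,linorder} \<Rightarrow> 'r) \<Rightarrow> nat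
       \<Rightarrow> ('k, ('n set \<Rightarrow> 'r) set) module" where
  "koszul_homology R \<phi> x i =
     \<lparr>carrier = koszul_class R x i ` koszul_cycles R x i,
      monoid.mult = undefined,
      one = undefined,
      ring.zero = koszul_boundaries R x i,
      add = set_add (exterior_algebra R),
      module.smult = (\<lambda>c C. \<Union>z\<in>C. koszul_class R x i (\<phi> c \<odot>\<^bsub>exterior_algebra R\<^esub> z))\<rparr>"


section \<open>The quotient ring and the lifted cycles\<close>

abbreviation qring :: "('n, 'k::field) mpoly set \<Rightarrow> ('n, 'k) mpoly set ring" where
  "qring I \<equiv> mpoly_ring Quot I"

definition bar :: "('n, 'k::field) mpoly set \<Rightarrow> ('n, 'k) mpoly \<Rightarrow> ('n, 'k) mpoly set" where
  "bar I f = I +>\<^bsub>mpoly_ring\<^esub> f"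

definition qvar :: "('n, 'k::field) mpoly set \<Rightarrow> 'n \<Rightarrow> ('n, 'k) mpoly set" where
  "qvar I i = bar I (xmon (xvar i))"

definition lift_cycle ::
    "('n::{finite,linorder}, 'k::field) mpoly set \<Rightarrow> 'n mon \<Rightarrow> 'n \<Rightarrow> 'n set
       \<Rightarrow> 'n set \<Rightarrow> ('n, 'k) mpoly set" where
  "lift_cycle I u l \<sigma> =
     bar I (xmon (u - xvar l)) \<odot>\<^bsub>exterior_algebra (qring I)\<^esub>
       (ext_basis (qring I) {l} \<otimes>\<^bsub>exterior_algebra (qring I)\<^esub> ext_basis (qring I) \<sigma>)"

end

theory Submission
  imports Defs "HOL-Library.Function_Algebras"
begin

text \<open>
  Induction on the number of generators.  Let \<open>J = (u\<^sub>1, \<dots>, u\<^sub>j\<^sub>-\<^sub>1)\<close>, \<open>u = u\<^sub>j\<close>, \<open>l = l(u)\<close>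
  and \<open>P = J : u = (x\<^sub>t. t \<in> set(u))\<close>.  The exact sequence
  \<open>0 \<rightarrow> S/P \<rightarrow> S/J \<rightarrow> S/(J + (u)) \<rightarrow> 0\<close>, whose first map is multiplication by \<open>u\<close>, induces a long
  exact sequence of Koszul homology.  The classes of the \<open>e\<^sub>\<sigma>\<close> with \<open>\<sigma> \<subseteq> set(u)\<close> form a basis of
  \<open>H(S/P)\<close>.  By the nice Koszul lifts property \<open>\<partial>((u/x\<^sub>l) e\<^sub>l \<and> e\<^sub>\<sigma>)\<close> is congruent to \<open>u e\<^sub>\<sigma>\<close> modulo
  \<open>J\<close>, so multiplication by \<open>u\<close> is zero on homology, and the connecting map sends the class of
  \<open>(u/x\<^sub>l) e\<^sub>l \<and> e\<^sub>\<sigma>\<close> to that of \<open>e\<^sub>\<sigma>\<close>.  Hence these classes extend a basis of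
  \<open>H\<^sub>i(S/J)\<close> to one of \<open>H\<^sub>i(S/(J + (u)))\<close> for \<open>i \<ge> 1\<close>.

  The diagram chases take place in the Koszul complex of \<open>S\<close> itself: cycles and boundaries of
  the Koszul complex of \<open>S/J\<close> are represented by chains over \<open>S\<close>, and equations hold modulo \<open>J\<close>.
\<close>

section \<open>Monomials and monomial ideals\<close>

abbreviation (input) "keys \<equiv> Poly_Mapping.keys"
abbreviation (input) "lookup \<equiv> Poly_Mapping.lookup"

lemma mdvd_iff_le: "mdvd u w \<longleftrightarrow> (\<forall>i. lookup u i \<le> lookup w i)"
proof
  assume "\<forall>i. lookup u i \<le> lookup w i"
  then have "w = u + (w - u)"
    by (intro poly_mapping_eqI) (simp add: lookup_add lookup_minus)
  then show "mdvd u w" unfolding mdvd_def by blast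
qed (auto simp: mdvd_def lookup_add)

lemma mdvd_xvar_iff:
  "mdvd (xvar i) w \<longleftrightarrow> lookup w i \<noteq> 0"
  "mdvd (Poly_Mapping.single i (Suc 0)) w \<longleftrightarrow> lookup w i \<noteq> 0"
  by (auto simp: mdvd_iff_le lookup_single when_def)

lemma mdvd_add_diff: "mdvd u w \<Longrightarrow> u + (w - u) = w"
  by (auto simp: mdvd_def)

lemma mdvd_refl: "mdvd u u"
  by (simp add: mdvd_iff_le)

lemma mdvd_trans: "mdvd u v \<Longrightarrow> mdvd v w \<Longrightarrow> mdvd u w"
  by (auto simp: mdvd_iff_le intro: order_trans)

lemma mdvd_add: "mdvd u w \<Longrightarrow> mdvd u (v + w)"
  by (auto simp: mdvd_iff_le lookup_add intro: trans_le_add2)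

lemma lookup_single_mult:
  fixes f :: "('n, 'k::field) mpoly"
  shows "lookup (Poly_Mapping.single v c * f) w =
    (if mdvd v w then c * lookup f (w - v) else 0)"
proof -
  have e: "(w = v + q) = (mdvd v w \<and> q = w - v)" for q
    by (auto simp: mdvd_def)
  have "lookup (Poly_Mapping.single v c * f) w =
      c * (\<Sum>q. lookup f q when w = v + q)"
    by (simp add: lookup_mult prod_fun_def lookup_single when_mult Sum_any_when_dependent_prod_right)
  also have "\<dots> = (if mdvd v w then c * lookup f (w - v) else 0)"
    by (simp add: e)
  finally show ?thesis .
qed

lemma lookup_xmon_mult:
  fixes f :: "('n, 'k::field) mpoly"
  shows "lookup (xmon v * f) w = (if mdvd v w then lookup f (w - v) else 0)"
  by (simp add: xmon_def lookup_single_mult)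

lemma keys_xmon_mult:
  fixes f :: "('n, 'k::field) mpoly"
  shows "keys (xmon v * f) = (+) v ` keys f"
proof (intro equalityI subsetI)
  fix w assume "w \<in> keys (xmon v * f)"
  then have "mdvd v w \<and> w - v \<in> keys f"
    by (auto simp: in_keys_iff lookup_xmon_mult split: if_splits)
  then show "w \<in> (+) v ` keys f" by (metis mdvd_add_diff image_eqI)
qed (auto simp: in_keys_iff lookup_xmon_mult mdvd_def)

lemma xmon_add: "xmon (u + v) = xmon u * xmon v"
  by (simp add: xmon_def mult_single)

lemma poly_mapping_sum_singles: "(\<Sum>w\<in>keys f. Poly_Mapping.single w (lookup f w)) = f"
proof (rule poly_mapping_eqI)
  fix w
  have "lookup (\<Sum>v\<in>keys f. Poly_Mapping.single v (lookup f v)) w =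
      (\<Sum>v\<in>keys f. if v = w then lookup f v else 0)"
    by (simp add: lookup_sum lookup_single when_def)
  also have "\<dots> = lookup f w" by (subst sum.delta) (auto simp: in_keys_iff)
  finally show "lookup (\<Sum>v\<in>keys f. Poly_Mapping.single v (lookup f v)) w = lookup f w" .
qed

section \<open>Closure properties of ideals generated by monomials, and a termwise membership
  test\<close>

lemma ideal_mon_gen: "ideal (mon_gen U :: ('n, 'k::field) mpoly set) mpoly_ring"
proof -
  interpret cring "mpoly_ring :: ('n, 'k) mpoly ring" by (rule cring_from_type_algebra)
  show ?thesis unfolding mon_gen_def by (rule genideal_ideal) (simp add: ring_of_type_algebra_def)
qed

lemma mon_gen_zero [simp]: "0 \<in> (mon_gen U :: ('n, 'k::field) mpoly set)"
  using additive_subgroup.zero_closed[OF ideal.axioms(1)[OF ideal_mon_gen]]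
  by (simp add: ring_of_type_algebra_def)

lemma mon_gen_add:
  fixes f g :: "('n, 'k::field) mpoly"
  assumes "f \<in> mon_gen U" "g \<in> mon_gen U"
  shows "f + g \<in> mon_gen U"
  using additive_subgroup.a_closed[OF ideal.axioms(1)[OF ideal_mon_gen] assms]
  by (simp add: ring_of_type_algebra_def)

lemma mon_gen_mult:
  fixes f g :: "('n, 'k::field) mpoly"
  assumes "f \<in> mon_gen U"
  shows "g * f \<in> mon_gen U"
  using ideal.I_l_closed[OF ideal_mon_gen assms, of g]
  by (simp add: ring_of_type_algebra_def)

lemma mon_gen_uminus:
  fixes f :: "('n, 'k::field) mpoly"
  assumes "f \<in> mon_gen U"
  shows "- f \<in> mon_gen U"
  using mon_gen_mult[OF assms, of "-1"] by simp

lemma mon_gen_diff: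
  fixes f g :: "('n, 'k::field) mpoly"
  assumes "f \<in> mon_gen U" "g \<in> mon_gen U"
  shows "f - g \<in> mon_gen U"
  using mon_gen_add[OF assms(1) mon_gen_uminus[OF assms(2)]] by simp

lemma mon_gen_sum:
  fixes f :: "'i \<Rightarrow> ('n, 'k::field) mpoly"
  assumes "\<And>x. x \<in> S \<Longrightarrow> f x \<in> mon_gen U"
  shows "sum f S \<in> mon_gen U"
  using assms by (induction S rule: infinite_finite_induct) (auto intro: mon_gen_add)

text \<open>The polynomials all of whose terms are divisible by a member of \<open>U\<close> already
  form an ideal containing the generators; conversely each such term is a multiple of a generator.
  Later membership questions are settled in this way by divisibility of exponent vectors.\<close>

lemma mon_gen_iff:
  fixes f :: "('n, 'k::field) mpoly"
  shows "f \<in> mon_gen U \<longleftrightarrow> (\<forall>w \<in> keys f. \<exists>u \<in> U. mdvd u w)"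
proof
  interpret cring "mpoly_ring :: ('n, 'k) mpoly ring" by (rule cring_from_type_algebra)
  let ?M = "{f :: ('n, 'k) mpoly. \<forall>w \<in> keys f. \<exists>u \<in> U. mdvd u w}"
  have mult: "g * f \<in> ?M" if "f \<in> ?M" for f g :: "('n, 'k) mpoly"
  proof safe
    fix w assume "w \<in> keys (g * f)"
    then obtain a b where "b \<in> keys f" "w = a + b" using keys_mult[of g f] by blast
    then show "\<exists>u\<in>U. mdvd u w" using that by (blast intro: mdvd_add)
  qed
  have zero: "0 \<in> ?M" by simp
  have add: "f + g \<in> ?M" if "f \<in> ?M" "g \<in> ?M" for f g :: "('n, 'k) mpoly"
    using that keys_add[of f g] by blast
  have "ideal ?M mpoly_ring"
  proof (rule idealI)
    show "subgroup ?M (add_monoid mpoly_ring)"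
    proof (rule add.subgroupI)
      show "?M \<noteq> {}" using zero by blast
      show "?M \<subseteq> carrier mpoly_ring" by (simp add: ring_of_type_algebra_def)
      show "f \<oplus>\<^bsub>mpoly_ring\<^esub> g \<in> ?M" if "f \<in> ?M" "g \<in> ?M" for f g
        using add[OF that] by (simp only: ring_of_type_algebra_def ring_record_simps)
      show "\<ominus>\<^bsub>mpoly_ring\<^esub> f \<in> ?M" if "f \<in> ?M" for f
      proof -
        have "\<ominus>\<^bsub>mpoly_ring\<^esub> f = - f"
          by (rule minus_equality) (simp_all add: ring_of_type_algebra_def)
        then show ?thesis using mult[OF that, of "-1"] by simp
      qed
    qed
    show "g \<otimes>\<^bsub>mpoly_ring\<^esub> f \<in> ?M" "f \<otimes>\<^bsub>mpoly_ring\<^esub> g \<in> ?M" if "f \<in> ?M" for f g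
      using mult[OF that, of g] by (simp_all only: ring_of_type_algebra_def monoid.simps mult.commute)
  qed (rule ring_from_type_algebra)
  moreover have "xmon ` U \<subseteq> ?M" by (auto simp: xmon_def intro: mdvd_refl)
  ultimately have "mon_gen U \<subseteq> ?M" unfolding mon_gen_def by (rule genideal_minimal)
  then show "f \<in> mon_gen U \<Longrightarrow> \<forall>w \<in> keys f. \<exists>u \<in> U. mdvd u w" by blast
next
  assume r: "\<forall>w \<in> keys f. \<exists>u \<in> U. mdvd u w"
  interpret cring "mpoly_ring :: ('n, 'k) mpoly ring" by (rule cring_from_type_algebra)
  have "Poly_Mapping.single w (lookup f w) \<in> mon_gen U" if w: "w \<in> keys f" for w
  proof -
    obtain u where u: "u \<in> U" "mdvd u w" using r w by blast
    have "xmon ` U \<subseteq> (mon_gen U :: ('n, 'k) mpoly set)"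
      unfolding mon_gen_def by (rule genideal_self) (simp add: ring_of_type_algebra_def)
    then have "Poly_Mapping.single (w - u) (lookup f w) * xmon u \<in> (mon_gen U :: ('n, 'k) mpoly set)"
      using u by (blast intro: mon_gen_mult)
    then show ?thesis using mdvd_add_diff[OF u(2)] by (simp add: xmon_def mult_single add.commute)
  qed
  then have "(\<Sum>w\<in>keys f. Poly_Mapping.single w (lookup f w)) \<in> mon_gen U" by (rule mon_gen_sum)
  then show "f \<in> mon_gen U" by (simp add: poly_mapping_sum_singles)
qed

lemma xmon_mem_mon_gen: "(xmon w :: ('n, 'k::field) mpoly) \<in> mon_gen U \<longleftrightarrow> (\<exists>u \<in> U. mdvd u w)"
  by (simp add: mon_gen_iff) (simp add: xmon_def)

lemma mon_gen_mono: "U \<subseteq> V \<Longrightarrow> (mon_gen U :: ('n, 'k::field) mpoly set) \<subseteq> mon_gen V"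
  by (meson mon_gen_iff subsetD subsetI)

text \<open>Division by u term by term: \<open>h\<close> collects the quotients of the terms that u
  divides, and every other term must already be divisible by a member of \<open>U\<close>.\<close>

lemma mon_gen_insertE:
  fixes f :: "('n, 'k::field) mpoly"
  assumes "f \<in> mon_gen (insert u U)"
  obtains h where "f - xmon u * h \<in> mon_gen U"
proof -
  have "\<exists>h. Poly_Mapping.single w (lookup f w) - xmon u * h \<in> mon_gen U" if w: "w \<in> keys f" for w
  proof (cases "mdvd u w")
    case True
    then have "Poly_Mapping.single w (lookup f w) - xmon u * Poly_Mapping.single (w - u) (lookup f w) = 0"
      by (simp add: xmon_def mult_single mdvd_add_diff)
    then show ?thesis by (metis mon_gen_zero)
  next
    case False
    then have "Poly_Mapping.single w (lookup f w) - xmon u * 0 \<in> mon_gen U"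
      using assms w by (auto simp: mon_gen_iff split: if_splits)
    then show ?thesis ..
  qed
  then obtain h where h: "Poly_Mapping.single w (lookup f w) - xmon u * h w \<in> mon_gen U"
    if "w \<in> keys f" for w by metis
  have "(\<Sum>w\<in>keys f. Poly_Mapping.single w (lookup f w) - xmon u * h w) \<in> mon_gen U"
    using h by (rule mon_gen_sum)
  then have "f - xmon u * (\<Sum>w\<in>keys f. h w) \<in> mon_gen U"
    by (simp add: sum_subtractf sum_distrib_left poly_mapping_sum_singles)
  then show thesis ..
qed

section \<open>The Koszul complex of the polynomial ring\<close>

text \<open>\<open>ksign\<close>, \<open>kdiff\<close>, \<open>kwedge\<close> and
  \<open>kbasis\<close> are \<open>ext_sign\<close>, \<open>koszul_diff\<close>, the product with
  e_i and \<open>ext_basis\<close> for a ring given by its type class. Chains over S thereby become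
  functions with pointwise addition, and the arithmetic of type classes applies to them.\<close>

definition ksign :: "'n::linorder \<Rightarrow> 'n set \<Rightarrow> 'r::comm_ring_1" where
  "ksign i \<tau> = (-1) ^ card {j \<in> \<tau>. j < i}"

definition kdiff :: "('n::{finite,linorder} \<Rightarrow> 'r::comm_ring_1) \<Rightarrow> ('n set \<Rightarrow> 'r) \<Rightarrow> 'n set \<Rightarrow> 'r" where
  "kdiff x a = (\<lambda>\<tau>. \<Sum>i\<in>-\<tau>. ksign i \<tau> * (x i * a (insert i \<tau>)))"

definition kwedge :: "'n::linorder \<Rightarrow> ('n set \<Rightarrow> 'r::comm_ring_1) \<Rightarrow> 'n set \<Rightarrow> 'r" where
  "kwedge i a = (\<lambda>\<rho>. if i \<in> \<rho> then ksign i (\<rho> - {i}) * a (\<rho> - {i}) else 0)"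

definition kbasis :: "'n set \<Rightarrow> 'n set \<Rightarrow> 'r::comm_ring_1" where
  "kbasis \<sigma> = (\<lambda>\<rho>. if \<rho> = \<sigma> then 1 else 0)"

definition kscale :: "'r::comm_ring_1 \<Rightarrow> ('n set \<Rightarrow> 'r) \<Rightarrow> 'n set \<Rightarrow> 'r" where
  "kscale f a = (\<lambda>\<rho>. f * a \<rho>)"

lemma ring_of_type_algebra_ops:
  "carrier (ring_of_type_algebra :: 'r::comm_ring_1 ring) = UNIV"
  "a \<otimes>\<^bsub>ring_of_type_algebra\<^esub> b = a * b"
  "a \<oplus>\<^bsub>ring_of_type_algebra\<^esub> b = a + b"
  "\<zero>\<^bsub>ring_of_type_algebra\<^esub> = (0 :: 'r)"
  "\<one>\<^bsub>ring_of_type_algebra\<^esub> = (1 :: 'r)" for a b :: "'r::comm_ring_1"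
  by (simp_all add: ring_of_type_algebra_def)

lemma nat_pow_ring_of_type_algebra:
  "a [^]\<^bsub>ring_of_type_algebra\<^esub> (n::nat) = (a::'r::comm_ring_1) ^ n"
  by (induction n) (simp_all add: ring_of_type_algebra_def nat_pow_def mult.commute)

lemma a_inv_ring_of_type_algebra:
  "\<ominus>\<^bsub>ring_of_type_algebra\<^esub> a = - (a::'r::comm_ring_1)"
proof -
  interpret cring "ring_of_type_algebra :: 'r ring" by (rule cring_from_type_algebra)
  show ?thesis by (rule minus_equality) (simp_all add: ring_of_type_algebra_def)
qed

lemma finsum_ring_of_type_algebra:
  fixes f :: "'i \<Rightarrow> 'r::comm_ring_1"
  assumes "finite S"
  shows "finsum ring_of_type_algebra f S = sum f S"
proof -
  interpret cring "ring_of_type_algebra :: 'r ring" by (rule cring_from_type_algebra)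
  have c: "f \<in> T \<rightarrow> carrier ring_of_type_algebra" for T by (simp add: ring_of_type_algebra_def)
  show ?thesis using assms
  proof (induction S)
    case (insert i S)
    then show ?case
      using finsum_insert[OF insert.hyps c, of]
      by (simp add: ring_of_type_algebra_def)
  qed (simp add: ring_of_type_algebra_ops)
qed

lemma ext_sign_ring_of_type_algebra:
  "ext_sign ring_of_type_algebra {i} \<tau> = (ksign i \<tau> :: 'r::comm_ring_1)"
  by (simp add: ext_sign_singleton nat_pow_ring_of_type_algebra a_inv_ring_of_type_algebra
      ring_of_type_algebra_ops ksign_def)

lemma koszul_diff_ring_of_type_algebra:
  "koszul_diff ring_of_type_algebra x a = kdiff (x :: _ \<Rightarrow> 'r::comm_ring_1) a"
  by (simp add: koszul_diff_def kdiff_def finsum_ring_of_type_algebra ext_sign_ring_of_type_algebra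
      ring_of_type_algebra_ops)

lemma exterior_ring_of_type_algebra_carrier:
  "carrier (exterior_algebra (ring_of_type_algebra :: 'r::comm_ring_1 ring)) = UNIV"
  by (simp add: exterior_algebra_def ring_of_type_algebra_ops)

lemma wedge_ring_of_type_algebra:
  fixes a :: "'n::{finite,linorder} set \<Rightarrow> 'r::comm_ring_1"
  shows "ext_basis ring_of_type_algebra {i} \<otimes>\<^bsub>exterior_algebra ring_of_type_algebra\<^esub> a = kwedge i a"
proof -
  interpret cring "ring_of_type_algebra :: 'r ring" by (rule cring_from_type_algebra)
  show ?thesis
    by (rule ext) (simp add: ext_basis_wedge exterior_ring_of_type_algebra_carrier kwedge_def
        ext_sign_ring_of_type_algebra ring_of_type_algebra_ops)
qed

lemma ksign_square [simp]: "ksign i \<tau> * ksign i \<tau> = (1 :: 'r::comm_ring_1)"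
  by (simp add: ksign_def flip: power_mult_distrib)

text \<open>The Leibniz rule, inherited from \<open>koszul_diff_wedge\<close> by viewing the
  type-class ring as a ring record.\<close>

lemma kdiff_kwedge: "kdiff x (kwedge i a) = kscale (x i) a - kwedge i (kdiff x a)"
proof -
  interpret cring "ring_of_type_algebra :: 'b ring" by (rule cring_from_type_algebra)
  show ?thesis using koszul_diff_wedge[of x a i]
    by (simp add: koszul_diff_ring_of_type_algebra exterior_ring_of_type_algebra_carrier
       wedge_ring_of_type_algebra ring_of_type_algebra_ops minus_eq a_inv_ring_of_type_algebra
       kscale_def fun_diff_def)
qed

text \<open>For i < j, adjoining i to \<tau> adds one element below j, while adjoining j adds none
  below i; so exactly one factor changes sign. The other order follows by symmetry.\<close>

lemma ksign_swap:
  fixes i j :: "'n::{finite,linorder}"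
  assumes "i \<notin> \<tau>" "j \<notin> \<tau>" "i \<noteq> j"
  shows "ksign i \<tau> * ksign j (insert i \<tau>) = - (ksign j \<tau> * ksign i (insert j \<tau>) :: 'r::comm_ring_1)"
  using assms
proof (induction i j rule: linorder_wlog)
  case (le i j)
  then have "i < j" by simp
  then have "{k \<in> insert i \<tau>. k < j} = insert i {k \<in> \<tau>. k < j}"
    "{k \<in> insert j \<tau>. k < i} = {k \<in> \<tau>. k < i}"
    by auto
  then show ?case using le by (simp add: ksign_def mult.commute)
next
  case (sym i j)
  then show ?case by simp
qed

text \<open>The pairs with i < j cancel against those with j < i. Comparing the whole sum with its
  transpose would only show that twice the sum is 0, which is not enough in characteristic
  2.\<close>

lemma sum_antisym_eq_zero:
  fixes F :: "'n::linorder \<Rightarrow> 'n \<Rightarrow> 'r::ab_group_add"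
  assumes "finite S" and "\<And>i j. i \<in> S \<Longrightarrow> j \<in> S \<Longrightarrow> i \<noteq> j \<Longrightarrow> F i j = - F j i"
  shows "(\<Sum>i\<in>S. \<Sum>j\<in>S - {i}. F i j) = 0"
proof -
  let ?L = "{(i, j). i \<in> S \<and> j \<in> S \<and> i < j}" and ?G = "{(i, j). i \<in> S \<and> j \<in> S \<and> j < i}"
  have fin: "finite ?L" "finite ?G"
    using assms(1) by (auto intro: finite_subset[of _ "S \<times> S"])
  have "(\<Sum>i\<in>S. \<Sum>j\<in>S - {i}. F i j) = (\<Sum>(i, j)\<in>Sigma S (\<lambda>i. S - {i}). F i j)"
    using assms(1) by (simp add: sum.Sigma)
  also have "Sigma S (\<lambda>i. S - {i}) = ?L \<union> ?G" by auto
  also have "(\<Sum>(i, j)\<in>?L \<union> ?G. F i j) = (\<Sum>(i, j)\<in>?L. F i j) + (\<Sum>(i, j)\<in>?G. F i j)"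
    by (rule sum.union_disjoint[OF fin]) auto
  also have "(\<Sum>(i, j)\<in>?G. F i j) = (\<Sum>(i, j)\<in>?L. F j i)"
    by (rule sum.reindex_bij_witness[of _ prod.swap prod.swap]) auto
  also have "(\<Sum>(i, j)\<in>?L. F j i) = (\<Sum>(i, j)\<in>?L. - F i j)"
    using assms(2) by (intro sum.cong) auto
  also have "\<dots> = - (\<Sum>(i, j)\<in>?L. F i j)" by (simp add: sum_negf case_prod_beta)
  finally show ?thesis by simp
qed

text \<open>Two different indices can be adjoined to \<tau> in either order; by
  \<open>ksign_swap\<close> the two contributions have opposite signs.\<close>

lemma kdiff_kdiff [simp]: "kdiff x (kdiff x a) = 0"
proof (rule ext)
  fix \<tau> :: "'a set"
  let ?F = "\<lambda>i j. ksign i \<tau> * ksign j (insert i \<tau>) * (x i * x j * a (insert i (insert j \<tau>)))"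
  have "kdiff x (kdiff x a) \<tau> = (\<Sum>i\<in>-\<tau>. \<Sum>j\<in>-\<tau> - {i}. ?F i j)"
    unfolding kdiff_def sum_distrib_left
    by (intro sum.cong) (auto simp: algebra_simps insert_commute)
  also have "\<dots> = 0"
  proof (rule sum_antisym_eq_zero)
    fix i j assume ij: "i \<in> - \<tau>" "j \<in> - \<tau>" "i \<noteq> j"
    have "x i * x j * a (insert i (insert j \<tau>)) = x j * x i * a (insert j (insert i \<tau>))"
      by (simp add: insert_commute mult.commute)
    moreover have "ksign i \<tau> * ksign j (insert i \<tau>) = - (ksign j \<tau> * ksign i (insert j \<tau>) :: 'b)"
      using ij by (intro ksign_swap) auto
    ultimately show "?F i j = - ?F j i" by simp
  qed simp
  finally show "kdiff x (kdiff x a) \<tau> = 0 \<tau>" by simp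
qed

lemma kdiff_add: "kdiff x (a + b) = kdiff x a + kdiff x b"
  by (rule ext) (simp add: kdiff_def distrib_left sum.distrib)

lemma kdiff_uminus: "kdiff x (- a) = - kdiff x a"
  by (rule ext) (simp add: kdiff_def sum_negf)

lemma kdiff_diff: "kdiff x (a - b) = kdiff x a - kdiff x b"
  by (rule ext) (simp add: kdiff_def right_diff_distrib sum_subtractf)

lemma kdiff_zero [simp]: "kdiff x 0 = 0"
  by (rule ext) (simp add: kdiff_def)

lemma kdiff_kscale: "kdiff x (kscale f a) = kscale f (kdiff x a)"
  by (rule ext) (simp add: kdiff_def kscale_def sum_distrib_left algebra_simps)

lemma kdiff_sum: "kdiff x (sum f S) = (\<Sum>s\<in>S. kdiff x (f s))"
  by (induction S rule: infinite_finite_induct) (simp_all only: sum.infinite sum.empty sum.insert kdiff_add kdiff_zero not_False_eq_True)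

lemma kscale_add: "kscale f (a + b) = kscale f a + kscale f b"
  by (rule ext) (simp add: kscale_def algebra_simps)

lemma kscale_add_left: "kscale (f + g) a = kscale f a + kscale g a"
  by (rule ext) (simp add: kscale_def algebra_simps)

lemma kscale_diff: "kscale f (a - b) = kscale f a - kscale f b"
  by (rule ext) (simp add: kscale_def algebra_simps)

lemma kscale_zero [simp]: "kscale f 0 = 0"
  by (rule ext) (simp add: kscale_def)

lemma kscale_kscale: "kscale f (kscale g a) = kscale (f * g) a"
  by (rule ext) (simp add: kscale_def mult.assoc)

lemma kscale_commute: "kscale f (kscale g a) = kscale g (kscale f a)"
  by (simp add: kscale_kscale mult.commute)

lemma kscale_sum: "kscale f (sum g S) = (\<Sum>s\<in>S. kscale f (g s))"
  by (induction S rule: infinite_finite_induct) (simp_all only: sum.infinite sum.empty sum.insert kscale_add kscale_zero not_False_eq_True)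

lemma sum_fun_apply: "(\<Sum>s\<in>S. f s) \<tau> = (\<Sum>s\<in>S. f s \<tau>)"
  by (induction S rule: infinite_finite_induct) simp_all

section \<open>The grading of chains\<close>

definition kchains :: "nat \<Rightarrow> ('n set \<Rightarrow> 'r::comm_ring_1) set" where
  "kchains k = {a. \<forall>\<sigma>. card \<sigma> \<noteq> k \<longrightarrow> a \<sigma> = 0}"

lemma kchains_zero [simp]: "0 \<in> kchains k"
  by (simp add: kchains_def)

lemma kchains_add: "a \<in> kchains k \<Longrightarrow> b \<in> kchains k \<Longrightarrow> a + b \<in> kchains k"
  by (simp add: kchains_def)

lemma kchains_diff: "a \<in> kchains k \<Longrightarrow> b \<in> kchains k \<Longrightarrow> a - b \<in> kchains k"
  by (simp add: kchains_def)

lemma kchains_sum: "(\<And>s. s \<in> S \<Longrightarrow> f s \<in> kchains k) \<Longrightarrow> sum f S \<in> kchains k"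
  by (induction S rule: infinite_finite_induct) (simp_all add: kchains_add)

lemma kchains_kscale: "a \<in> kchains k \<Longrightarrow> kscale f a \<in> kchains k"
  by (simp add: kchains_def kscale_def)

lemma kchains_kbasis: "card \<sigma> = k \<Longrightarrow> kbasis \<sigma> \<in> kchains k"
  by (auto simp: kchains_def kbasis_def)

lemma kchains_kwedge:
  fixes a :: "'n::{finite,linorder} set \<Rightarrow> 'r::comm_ring_1"
  assumes "a \<in> kchains k"
  shows "kwedge i a \<in> kchains (Suc k)"
proof -
  have "kwedge i a \<sigma> = 0" if "card \<sigma> \<noteq> Suc k" for \<sigma>
  proof (cases "i \<in> \<sigma>")
    case True
    then have "card (\<sigma> - {i}) \<noteq> k" using that card_Suc_Diff1[OF finite True] by metis
    then have "a (\<sigma> - {i}) = 0" using assms unfolding kchains_def by blast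
    then show ?thesis by (simp add: kwedge_def)
  qed (simp add: kwedge_def)
  then show ?thesis by (simp add: kchains_def)
qed

lemma kchains_kdiff:
  assumes "a \<in> kchains (Suc k)"
  shows "kdiff x a \<in> kchains k"
proof -
  have "kdiff x a \<sigma> = 0" if "card \<sigma> \<noteq> k" for \<sigma>
  proof -
    have "a (insert i \<sigma>) = 0" if "i \<notin> \<sigma>" for i
      using assms that \<open>card \<sigma> \<noteq> k\<close> by (simp add: kchains_def)
    then show ?thesis by (simp add: kdiff_def)
  qed
  then show ?thesis by (simp add: kchains_def)
qed

section \<open>Cycles modulo an ideal generated by variables\<close>

text \<open>The part of \<open>f\<close> divisible by the variable \<open>x\<^sub>m\<close>, divided by \<open>x\<^sub>m\<close>.\<close>

definition xquot :: "'n \<Rightarrow> ('n, 'k::field) mpoly \<Rightarrow> ('n, 'k) mpoly" where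
  "xquot m f = Poly_Mapping.map_key ((+) (xvar m)) f"

lemma lookup_xquot: "lookup (xquot m f) w = lookup f (xvar m + w)"
  unfolding xquot_def by (subst map_key.rep_eq) (auto simp: inj_on_def)

lemma xquot_add: "xquot m (f + g) = xquot m f + xquot m g"
  by (rule poly_mapping_eqI) (simp add: lookup_xquot lookup_add)

lemma xquot_zero [simp]: "xquot m 0 = 0"
  by (rule poly_mapping_eqI) (simp add: lookup_xquot)

lemma xquot_uminus: "xquot m (- f) = - xquot m f"
  by (rule poly_mapping_eqI) (simp add: lookup_xquot)

lemma xquot_sum: "xquot m (sum f S) = (\<Sum>s\<in>S. xquot m (f s))"
  by (induction S rule: infinite_finite_induct) (simp_all add: xquot_add)

lemma xquot_ksign: "xquot m (ksign i \<tau> * f) = ksign i \<tau> * xquot m f"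
  by (cases "even (card {j \<in> \<tau>. j < i})") (simp_all add: ksign_def xquot_uminus)

lemma xquot_xvar_mult: "xquot m (xmon (xvar m) * f) = f"
  by (rule poly_mapping_eqI) (simp add: lookup_xquot lookup_xmon_mult mdvd_def)

lemma xquot_xvar_mult_other:
  assumes "i \<noteq> m"
  shows "xquot m (xmon (xvar i) * f) = xmon (xvar i) * xquot m f"
proof (rule poly_mapping_eqI)
  fix w
  have "mdvd (xvar i) (xvar m + w) \<longleftrightarrow> mdvd (xvar i) w"
    using assms by (simp add: mdvd_xvar_iff lookup_add lookup_single when_def)
  moreover have "xvar m + w - xvar i = xvar m + (w - xvar i)" if "mdvd (xvar i) w"
    using mdvd_add_diff[OF that] by (metis add.left_commute add_diff_cancel_left')
  ultimately show "lookup (xquot m (xmon (xvar i) * f)) w = lookup (xmon (xvar i) * xquot m f) w"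
    by (simp add: lookup_xquot lookup_xmon_mult)
qed

lemma lookup_xvar_remainder:
  "lookup (f - xmon (xvar m) * xquot m f) w = (if lookup w m = 0 then lookup f w else 0)"
proof (cases "mdvd (xvar m) w")
  case True
  then show ?thesis
    by (simp only: lookup_minus lookup_xmon_mult lookup_xquot mdvd_add_diff) (simp add: mdvd_xvar_iff)
next
  case False
  then show ?thesis
    by (simp only: lookup_minus lookup_xmon_mult) (simp add: mdvd_xvar_iff)
qed

text \<open>A variable x_t with t in \<open>A\<close> differs from x_m, so if it divides x_m w it
  divides w. Hence \<open>khtpy m\<close> respects coefficients in the ideal of \<open>A\<close> as
  long as m lies outside \<open>A\<close>.\<close>

lemma xquot_mem_mon_gen:
  assumes "f \<in> mon_gen (xvar ` A)" "m \<notin> A"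
  shows "xquot m f \<in> mon_gen (xvar ` A)"
  unfolding mon_gen_iff
proof
  fix w assume "w \<in> keys (xquot m f)"
  then have "xvar m + w \<in> keys f" by (simp add: in_keys_iff lookup_xquot)
  then obtain t where "t \<in> A" "mdvd (xvar t) (xvar m + w)" using assms(1) by (auto simp: mon_gen_iff)
  then show "\<exists>u \<in> xvar ` A. mdvd u w"
    using assms(2) by (auto simp: mdvd_xvar_iff lookup_add lookup_single when_def split: if_splits)
qed

abbreviation pdiff :: "('n::{finite,linorder} set \<Rightarrow> ('n, 'k::field) mpoly) \<Rightarrow> 'n set \<Rightarrow> ('n, 'k) mpoly" where
  "pdiff \<equiv> kdiff (\<lambda>i. xmon (xvar i))"

text \<open>
  The operator \<open>khtpy m\<close> is a homotopy between the identity and the projection onto the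
  terms that involve neither \<open>x\<^sub>m\<close> nor \<open>e\<^sub>m\<close>; in contrast to the Euler homotopy it needs no
  division by integers.
\<close>

definition khtpy :: "'n::{finite,linorder} \<Rightarrow> ('n set \<Rightarrow> ('n, 'k::field) mpoly) \<Rightarrow> 'n set \<Rightarrow> ('n, 'k) mpoly" where
  "khtpy m a = kwedge m (\<lambda>\<tau>. xquot m (a \<tau>))"

definition kproj :: "'n \<Rightarrow> ('n set \<Rightarrow> ('n, 'k::field) mpoly) \<Rightarrow> 'n set \<Rightarrow> ('n, 'k) mpoly" where
  "kproj m a = (\<lambda>\<tau>. if m \<in> \<tau> then 0 else a \<tau> - xmon (xvar m) * xquot m (a \<tau>))"

text \<open>With q the quotient of a by x_m, the Leibniz rule turns the first summand into x_m q
  minus the product of e_m with the differential of q. Taking the quotient by x_m commutes with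
  every x_i except x_m. So for m in \<tau> the second summand and that product differ only by the
  terms with i = m, and these leave a itself.\<close>

lemma khtpy_homotopy: "pdiff (khtpy m a) + khtpy m (pdiff a) = a - kproj m a"
proof (rule ext)
  fix \<tau> :: "'a set"
  let ?x = "\<lambda>i. xmon (xvar i) :: ('a, 'b) mpoly" and ?q = "\<lambda>\<tau>. xquot m (a \<tau>)"
  have D: "pdiff (khtpy m a) \<tau> = ?x m * ?q \<tau> - kwedge m (pdiff ?q) \<tau>"
    unfolding khtpy_def kdiff_kwedge by (simp add: kscale_def)
  show "(pdiff (khtpy m a) + khtpy m (pdiff a)) \<tau> = (a - kproj m a) \<tau>"
  proof (cases "m \<in> \<tau>")
    case False
    then show ?thesis unfolding plus_fun_apply D by (simp add: khtpy_def kwedge_def kproj_def)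
  next
    case True
    let ?t = "\<tau> - {m}"
    have c: "- ?t = insert m (- \<tau>)" "insert m ?t = \<tau>" using True by auto
    have "xquot m (pdiff a ?t) = (\<Sum>i\<in>-?t. ksign i ?t * xquot m (?x i * a (insert i ?t)))"
      unfolding kdiff_def xquot_sum xquot_ksign ..
    also have "\<dots> = ksign m ?t * a \<tau> + (\<Sum>i\<in>-\<tau>. ksign i ?t * (?x i * ?q (insert i ?t)))"
    proof -
      have "xquot m (?x i * a (insert i ?t)) = ?x i * ?q (insert i ?t)" if "i \<in> - \<tau>" for i
        using that True by (intro xquot_xvar_mult_other) auto
      moreover have "m \<notin> - \<tau>" using True by simp
      ultimately show ?thesis unfolding c(1)
        by (subst sum.insert) (simp_all only: finite not_False_eq_True xquot_xvar_mult c(2) cong: sum.cong)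
    qed
    finally have 1: "xquot m (pdiff a ?t) =
      ksign m ?t * a \<tau> + (\<Sum>i\<in>-\<tau>. ksign i ?t * (?x i * ?q (insert i ?t)))" .
    have 2: "pdiff ?q ?t = ksign m ?t * (?x m * ?q \<tau>) + (\<Sum>i\<in>-\<tau>. ksign i ?t * (?x i * ?q (insert i ?t)))"
      unfolding kdiff_def c(1) using True by (subst sum.insert) (auto simp: c(2) insert_absorb)
    have "khtpy m (pdiff a) \<tau> - kwedge m (pdiff ?q) \<tau> =
        ksign m ?t * (xquot m (pdiff a ?t) - pdiff ?q ?t)"
      using True by (simp add: khtpy_def kwedge_def right_diff_distrib)
    also have "\<dots> = (ksign m ?t * ksign m ?t) * (a \<tau> - ?x m * ?q \<tau>)"
      unfolding 1 2 by (simp add: algebra_simps)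
    finally have "khtpy m (pdiff a) \<tau> - kwedge m (pdiff ?q) \<tau> = a \<tau> - ?x m * ?q \<tau>" by simp
    then show ?thesis unfolding plus_fun_apply D using True by (simp add: kproj_def algebra_simps)
  qed
qed

section \<open>Chains with coefficients in an ideal\<close>

definition coeffs_in :: "'r set \<Rightarrow> ('n set \<Rightarrow> 'r::comm_ring_1) set" where
  "coeffs_in J = {a. \<forall>\<tau>. a \<tau> \<in> J}"

context
  fixes U :: "'n::{finite,linorder} mon set"
begin

lemma coeffs_in_zero [simp]: "0 \<in> coeffs_in (mon_gen U :: ('n, 'k::field) mpoly set)"
  by (simp add: coeffs_in_def)

lemma coeffs_in_add:
  "a \<in> coeffs_in (mon_gen U :: ('n, 'k::field) mpoly set) \<Longrightarrow> b \<in> coeffs_in (mon_gen U) \<Longrightarrow>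
    a + b \<in> coeffs_in (mon_gen U)"
  by (simp add: coeffs_in_def mon_gen_add)

lemma coeffs_in_diff:
  "a \<in> coeffs_in (mon_gen U :: ('n, 'k::field) mpoly set) \<Longrightarrow> b \<in> coeffs_in (mon_gen U) \<Longrightarrow>
    a - b \<in> coeffs_in (mon_gen U)"
  by (simp add: coeffs_in_def mon_gen_diff)

lemma coeffs_in_uminus:
  "a \<in> coeffs_in (mon_gen U :: ('n, 'k::field) mpoly set) \<Longrightarrow> - a \<in> coeffs_in (mon_gen U)"
  by (simp add: coeffs_in_def mon_gen_uminus)

lemma coeffs_in_sum:
  "(\<And>s. s \<in> S \<Longrightarrow> f s \<in> coeffs_in (mon_gen U :: ('n, 'k::field) mpoly set)) \<Longrightarrow>
    sum f S \<in> coeffs_in (mon_gen U)"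
  by (induction S rule: infinite_finite_induct) (simp_all add: coeffs_in_add del: zero_fun_apply)

lemma coeffs_in_kscale:
  "a \<in> coeffs_in (mon_gen U :: ('n, 'k::field) mpoly set) \<Longrightarrow> kscale f a \<in> coeffs_in (mon_gen U)"
  by (simp add: coeffs_in_def kscale_def mon_gen_mult)

lemma coeffs_in_kdiff:
  "a \<in> coeffs_in (mon_gen U :: ('n, 'k::field) mpoly set) \<Longrightarrow> kdiff x a \<in> coeffs_in (mon_gen U)"
  by (simp add: coeffs_in_def kdiff_def mon_gen_mult mon_gen_sum)

lemma coeffs_in_kwedge:
  "a \<in> coeffs_in (mon_gen U :: ('n, 'k::field) mpoly set) \<Longrightarrow> kwedge i a \<in> coeffs_in (mon_gen U)"
  by (simp add: coeffs_in_def kwedge_def mon_gen_mult)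

end

lemma coeffs_in_khtpy:
  "a \<in> coeffs_in (mon_gen (xvar ` A)) \<Longrightarrow> m \<notin> A \<Longrightarrow> khtpy m a \<in> coeffs_in (mon_gen (xvar ` A))"
  unfolding khtpy_def coeffs_in_def[of "mon_gen _"]
  by (rule coeffs_in_kwedge[unfolded coeffs_in_def]) (blast intro: xquot_mem_mon_gen)

text \<open>For an ideal J these are preimages over S of the cycles and boundaries of the Koszul
  complex of S/J. A member of \<open>qbounds\<close> may have components outside degree k, but only
  with values in J.\<close>

definition qcycles :: "('n::{finite,linorder}, 'k::field) mpoly set \<Rightarrow> nat \<Rightarrow> ('n set \<Rightarrow> ('n, 'k) mpoly) set" where
  "qcycles J k = {a \<in> kchains k. pdiff a \<in> coeffs_in J}"

definition qbounds :: "('n::{finite,linorder}, 'k::field) mpoly set \<Rightarrow> nat \<Rightarrow> ('n set \<Rightarrow> ('n, 'k) mpoly) set" where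
  "qbounds J k = {a. \<exists>b \<in> kchains (Suc k). a - pdiff b \<in> coeffs_in J}"

text \<open>The indices of \<open>M\<close> are removed one at a time by
  \<open>khtpy_homotopy\<close>. For m outside \<open>A\<close> the term
  \<open>khtpy m (pdiff a)\<close> has coefficients in the ideal of \<open>A\<close>, so the
  projection \<open>kproj m\<close> changes a cycle modulo that ideal only by a boundary.\<close>

lemma qcycles_eliminate:
  fixes a :: "'n::{finite,linorder} set \<Rightarrow> ('n, 'k::field) mpoly"
  assumes "finite M" "M \<inter> A = {}" "a \<in> qcycles (mon_gen (xvar ` A)) k"
  shows "\<exists>a' \<in> qcycles (mon_gen (xvar ` A)) k. a - a' \<in> qbounds (mon_gen (xvar ` A)) k \<and>
    (\<forall>m \<in> M. \<forall>\<tau>. (m \<in> \<tau> \<longrightarrow> a' \<tau> = 0) \<and> (\<forall>w \<in> keys (a' \<tau>). lookup w m = 0))"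
  using assms
proof (induction M)
  case empty
  have "a - a \<in> qbounds (mon_gen (xvar ` A)) k"
    unfolding qbounds_def
    by (rule CollectI, rule bexI[of _ 0]) (simp_all only: kdiff_zero diff_self coeffs_in_zero kchains_zero)
  then show ?case using empty by blast
next
  case (insert m M)
  let ?P = "mon_gen (xvar ` A) :: ('n, 'k) mpoly set"
  obtain a' b where a': "a' \<in> kchains k" "pdiff a' \<in> coeffs_in ?P" and b: "b \<in> kchains (Suc k)"
      "a - a' - pdiff b \<in> coeffs_in ?P" and
      r: "\<And>n \<tau>. n \<in> M \<Longrightarrow> n \<in> \<tau> \<Longrightarrow> a' \<tau> = 0" "\<And>n \<tau> w. n \<in> M \<Longrightarrow> w \<in> keys (a' \<tau>) \<Longrightarrow> lookup w n = 0"
  proof -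
    obtain a' where a': "a' \<in> qcycles ?P k" "a - a' \<in> qbounds ?P k" and
      r: "\<forall>m \<in> M. \<forall>\<tau>. (m \<in> \<tau> \<longrightarrow> a' \<tau> = 0) \<and> (\<forall>w \<in> keys (a' \<tau>). lookup w m = 0)"
      using insert.IH insert.prems by blast
    obtain b where b: "b \<in> kchains (Suc k)" "a - a' - pdiff b \<in> coeffs_in ?P"
      using a'(2) unfolding qbounds_def by blast
    show thesis
      by (rule that[OF _ _ b]) (use a'(1) r in \<open>simp_all add: qcycles_def\<close>)
  qed
  have h: "khtpy m (pdiff a') \<in> coeffs_in ?P"
    using a'(2) insert.prems by (intro coeffs_in_khtpy) auto
  have e: "kproj m a' = a' - (pdiff (khtpy m a') + khtpy m (pdiff a'))"
    unfolding khtpy_homotopy by simp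
  have "kproj m a' \<in> kchains k"
    using a'(1) by (simp add: kchains_def kproj_def)
  moreover have "pdiff (kproj m a') \<in> coeffs_in ?P"
  proof -
    have "pdiff (kproj m a') = pdiff a' - pdiff (khtpy m (pdiff a'))"
      unfolding e kdiff_diff kdiff_add kdiff_kdiff by simp
    then show ?thesis using a'(2) h by (simp add: coeffs_in_diff coeffs_in_kdiff)
  qed
  moreover have "a - kproj m a' \<in> qbounds ?P k"
  proof -
    have "khtpy m a' \<in> kchains (Suc k)" unfolding khtpy_def
      by (rule kchains_kwedge) (use a'(1) in \<open>simp add: kchains_def\<close>)
    then have "b + khtpy m a' \<in> kchains (Suc k)" using b(1) by (rule kchains_add[rotated])
    moreover have "a - kproj m a' - pdiff (b + khtpy m a') = (a - a' - pdiff b) + khtpy m (pdiff a')"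
      unfolding e kdiff_add by (simp add: algebra_simps)
    then have "a - kproj m a' - pdiff (b + khtpy m a') \<in> coeffs_in ?P"
      using b(2) h by (simp only: coeffs_in_add)
    ultimately show ?thesis unfolding qbounds_def by blast
  qed
  moreover
  \<comment> \<open>\<open>kproj m\<close> only deletes terms and components, so indices removed
    earlier do not come back.\<close>
  have "(n \<in> \<tau> \<longrightarrow> kproj m a' \<tau> = 0) \<and> (\<forall>w \<in> keys (kproj m a' \<tau>). lookup w n = 0)"
    if "n \<in> insert m M" for n \<tau>
    using that r(1)[of n \<tau>] r(2)[of n _ \<tau>]
    by (auto simp: kproj_def in_keys_iff lookup_xvar_remainder simp del: One_nat_def split: if_splits)
  then have "\<forall>n \<in> insert m M. \<forall>\<tau>. (n \<in> \<tau> \<longrightarrow> kproj m a' \<tau> = 0) \<and> (\<forall>w \<in> keys (kproj m a' \<tau>). lookup w n = 0)"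
    by (intro ballI allI)
  ultimately show ?case
    by (intro bexI[of _ "kproj m a'"]) (simp_all only: qcycles_def mem_Collect_eq simp_thms)
qed

text \<open>The spanning half of the computation of H(S/P) for P generated by the variables in
  \<open>A\<close>. Once all indices outside \<open>A\<close> are eliminated, only e_\<sigma> with
  \<sigma> inside \<open>A\<close> occur and every nonconstant term is divisible by a variable in
  \<open>A\<close>, so modulo P just the constant terms remain.\<close>

lemma qcycles_variables:
  fixes a :: "'n::{finite,linorder} set \<Rightarrow> ('n, 'k::field) mpoly"
  assumes "a \<in> qcycles (mon_gen (xvar ` A)) k"
  shows "\<exists>c. a - (\<Sum>\<sigma> | \<sigma> \<subseteq> A \<and> card \<sigma> = k. kscale (const (c \<sigma>)) (kbasis \<sigma>)) \<in> qbounds (mon_gen (xvar ` A)) k"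
proof -
  let ?P = "mon_gen (xvar ` A) :: ('n, 'k) mpoly set"
  obtain a' b where a': "a' \<in> kchains k" and b: "b \<in> kchains (Suc k)"
      "a - a' - pdiff b \<in> coeffs_in ?P" and
      r: "\<And>n \<tau>. n \<notin> A \<Longrightarrow> n \<in> \<tau> \<Longrightarrow> a' \<tau> = 0" "\<And>n \<tau> w. n \<notin> A \<Longrightarrow> w \<in> keys (a' \<tau>) \<Longrightarrow> lookup w n = 0"
  proof -
    obtain a' where a': "a' \<in> qcycles ?P k" "a - a' \<in> qbounds ?P k" and
      r: "\<forall>m \<in> - A. \<forall>\<tau>. (m \<in> \<tau> \<longrightarrow> a' \<tau> = 0) \<and> (\<forall>w \<in> keys (a' \<tau>). lookup w m = 0)"
      using qcycles_eliminate[OF finite _ assms, of "- A"] by auto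
    obtain b where b: "b \<in> kchains (Suc k)" "a - a' - pdiff b \<in> coeffs_in ?P"
      using a'(2) unfolding qbounds_def by blast
    show thesis
      by (rule that[OF _ b]) (use a'(1) r in \<open>simp_all add: qcycles_def\<close>)
  qed
  define c where "c \<sigma> = lookup (a' \<sigma>) 0" for \<sigma>
  let ?s = "\<Sum>\<sigma> | \<sigma> \<subseteq> A \<and> card \<sigma> = k. kscale (const (c \<sigma>)) (kbasis \<sigma>) :: 'n set \<Rightarrow> ('n, 'k) mpoly"
  have s: "?s \<tau> = (if \<tau> \<subseteq> A \<and> card \<tau> = k then const (c \<tau>) else 0)" for \<tau>
  proof -
    have "?s \<tau> = (\<Sum>\<sigma> | \<sigma> \<subseteq> A \<and> card \<sigma> = k. if \<tau> = \<sigma> then const (c \<sigma>) else 0)"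
      unfolding sum_fun_apply by (rule sum.cong) (auto simp: kscale_def kbasis_def)
    then show ?thesis by (simp add: sum.delta)
  qed
  have "(a' - ?s) \<tau> \<in> ?P" for \<tau>
  proof (cases "\<tau> \<subseteq> A \<and> card \<tau> = k")
    case True
    show ?thesis unfolding mon_gen_iff
    proof
      fix w assume "w \<in> keys ((a' - ?s) \<tau>)"
      then have "lookup (a' \<tau> - const (c \<tau>)) w \<noteq> 0" using True by (simp add: in_keys_iff s)
      then have w: "w \<in> keys (a' \<tau>)" "w \<noteq> 0"
        by (auto simp: in_keys_iff lookup_minus c_def const_def lookup_single when_def split: if_splits)
      then obtain t where t: "lookup w t \<noteq> 0" by (metis poly_mapping_eqI lookup_zero)
      then have "t \<in> A" using r(2)[of t w \<tau>] w(1) by metis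
      then show "\<exists>u \<in> xvar ` A. mdvd u w" using t by (auto simp: mdvd_xvar_iff)
    qed
  next
    case False
    then have "a' \<tau> = 0" using r(1) a' by (auto simp: kchains_def)
    moreover have "?s \<tau> = 0" unfolding s using False by (rule if_not_P)
    ultimately have "(a' - ?s) \<tau> = 0" by (simp only: fun_diff_def diff_self)
    then show ?thesis by (simp only: mon_gen_zero)
  qed
  then have "a' - ?s \<in> coeffs_in ?P" by (simp add: coeffs_in_def)
  then have "(a - a' - pdiff b) + (a' - ?s) \<in> coeffs_in ?P" using b(2) by (rule coeffs_in_add[rotated])
  then have "a - ?s - pdiff b \<in> coeffs_in ?P" by (simp add: algebra_simps)
  then have "a - ?s \<in> qbounds ?P k"
    unfolding qbounds_def using b(1) by (intro CollectI bexI[of _ b])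
  then show ?thesis by (rule exI[of _ c])
qed

section \<open>Adding one generator\<close>

text \<open>Each term of f is a multiple of some x_t with t in \<open>A\<close>, so only the
  products v x_t matter.\<close>

lemma xmon_mult_variables_mem:
  fixes f :: "('n, 'k::field) mpoly"
  assumes "f \<in> mon_gen (xvar ` A)" and "\<And>t. t \<in> A \<Longrightarrow> (xmon (v + xvar t) :: ('n, 'k) mpoly) \<in> mon_gen U"
  shows "xmon v * f \<in> mon_gen U"
  unfolding mon_gen_iff keys_xmon_mult
proof safe
  fix w assume "w \<in> keys f"
  then obtain t where t: "t \<in> A" "mdvd (xvar t) w" using assms(1) by (auto simp: mon_gen_iff)
  then obtain u where u: "u \<in> U" "mdvd u (v + xvar t)" using assms(2) unfolding xmon_mem_mon_gen by blast
  moreover have "mdvd (v + xvar t) (v + w)" using t(2) by (auto simp: mdvd_iff_le lookup_add)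
  ultimately show "\<exists>u\<in>U. mdvd u (v + w)" using mdvd_trans by blast
qed

lemma lookup_zero_variables: "f \<in> mon_gen (xvar ` A) \<Longrightarrow> lookup f 0 = 0"
  unfolding mon_gen_iff by (rule ccontr) (auto simp: mdvd_xvar_iff in_keys_iff dest!: bspec[of _ _ 0])

text \<open>Together with \<open>lookup_zero_variables\<close> this shows that boundaries have no
  constant terms; the independence of the e_\<sigma> modulo P rests on it.\<close>

lemma pdiff_mem_variables: "pdiff a \<tau> \<in> mon_gen (range xvar)"
  unfolding kdiff_def
proof (rule mon_gen_sum)
  fix i assume "i \<in> - \<tau>"
  have "xmon (xvar i) \<in> mon_gen (range xvar)" unfolding xmon_mem_mon_gen using mdvd_refl by blast
  then have "(ksign i \<tau> * a (insert i \<tau>)) * xmon (xvar i) \<in> mon_gen (range xvar)" by (rule mon_gen_mult)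
  then show "ksign i \<tau> * (xmon (xvar i) * a (insert i \<tau>)) \<in> mon_gen (range xvar)"
    by (simp add: mult_ac)
qed

text \<open>The differential removes an index i of \<sigma> at the price of a factor x_i. Thus
  e_\<sigma> is a cycle modulo P whenever \<sigma> is contained in \<open>A\<close>.\<close>

lemma pdiff_kbasis:
  fixes \<sigma> :: "'n::{finite,linorder} set"
  shows "pdiff (kbasis \<sigma>) \<in> coeffs_in (mon_gen (xvar ` \<sigma>))"
  unfolding coeffs_in_def kdiff_def
proof (intro CollectI allI mon_gen_sum, rule mon_gen_mult)
  fix \<tau> :: "'n set" and i assume "i \<in> - \<tau>"
  show "xmon (xvar i) * kbasis \<sigma> (insert i \<tau>) \<in> mon_gen (xvar ` \<sigma>)"
  proof (cases "insert i \<tau> = \<sigma>")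
    case True
    then have "i \<in> \<sigma>" by blast
    then have "xmon (xvar i) \<in> mon_gen (xvar ` \<sigma>)"
      unfolding xmon_mem_mon_gen using mdvd_refl by blast
    then show ?thesis using True by (simp add: kbasis_def)
  qed (simp add: kbasis_def)
qed

lemma kscale_kwedge: "kscale f (kwedge i a) = kwedge i (kscale f a)"
  by (rule ext) (simp add: kscale_def kwedge_def mult_ac)

text \<open>A representative over S of \<open>lift_cycle\<close>, see
  \<open>lift_cycle_eq_kbar\<close>.\<close>

definition klift :: "'n::{finite,linorder} mon \<Rightarrow> 'n \<Rightarrow> 'n set \<Rightarrow> 'n set \<Rightarrow> ('n, 'k::field) mpoly" where
  "klift u l \<sigma> = kscale (xmon (u - xvar l)) (kwedge l (kbasis \<sigma>))"

lemma kchains_klift: "card \<sigma> = k \<Longrightarrow> klift u l \<sigma> \<in> kchains (Suc k)"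
  unfolding klift_def by (intro kchains_kscale kchains_kwedge kchains_kbasis)

lemma coeffs_in_insertE:
  fixes a :: "'n::{finite,linorder} set \<Rightarrow> ('n, 'k::field) mpoly"
  assumes "a \<in> coeffs_in (mon_gen (insert u U))" "a \<in> kchains k"
  obtains q where "q \<in> kchains k" "a - kscale (xmon u) q \<in> coeffs_in (mon_gen U)"
proof -
  have "\<exists>h. a \<tau> - xmon u * h \<in> mon_gen U" for \<tau>
    using assms(1) mon_gen_insertE[of "a \<tau>" u U] unfolding coeffs_in_def by blast
  then obtain h where h: "a \<tau> - xmon u * h \<tau> \<in> mon_gen U" for \<tau> by metis
  \<comment> \<open>The quotients chosen componentwise may be nonzero outside degree k, so they are
    cut off there.\<close>
  define q where "q \<tau> = (if card \<tau> = k then h \<tau> else 0)" for \<tau>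
  have "(a - kscale (xmon u) q) \<tau> \<in> mon_gen U" for \<tau>
    using h[of \<tau>] assms(2) by (simp add: q_def kscale_def kchains_def)
  then show thesis by (intro that[of q]) (simp_all add: q_def kchains_def coeffs_in_def)
qed

text \<open>One step of the induction: u is adjoined to the ideal J of \<open>U\<close>, and
  \<open>colon\<close> identifies J : u with P. The nice Koszul lifts property enters as
  \<open>nice\<close>, which places (u / x_l) x_t in J.\<close>

context
  fixes U :: "'n::{finite,linorder} mon set" and u :: "'n mon" and l :: 'n and A :: "'n set"
    and J :: "('n, 'k::field) mpoly set" and P :: "('n, 'k) mpoly set"
  defines "J \<equiv> mon_gen U" and "P \<equiv> mon_gen (xvar ` A)"
  assumes l: "mdvd (xvar l) u"
    and colon: "\<And>f. xmon u * f \<in> J \<longleftrightarrow> f \<in> P"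
    and nice: "\<And>t. t \<in> A \<Longrightarrow> xmon (u - xvar l + xvar t) \<in> J"
begin

text \<open>By the Leibniz rule the difference is the product of e_l with u / x_l times the
  differential of e_\<sigma>. The latter has coefficients in P by \<open>pdiff_kbasis\<close>, and
  by \<open>nice\<close> the monomial u / x_l multiplies P into J.\<close>

lemma pdiff_klift:
  assumes "\<sigma> \<subseteq> A"
  shows "kscale (xmon u) (kbasis \<sigma>) - pdiff (klift u l \<sigma>) \<in> coeffs_in J"
proof -
  let ?w = "kscale (xmon (u - xvar l)) (pdiff (kbasis \<sigma>)) :: 'n set \<Rightarrow> ('n, 'k) mpoly"
  have x: "xmon (u - xvar l) * xmon (xvar l) = (xmon u :: ('n, 'k) mpoly)"
    using mdvd_add_diff[OF l] by (simp only: xmon_add[symmetric] add.commute)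
  have "pdiff (klift u l \<sigma>) = kscale (xmon (u - xvar l) * xmon (xvar l)) (kbasis \<sigma>) - kwedge l ?w"
    unfolding klift_def kdiff_kscale kdiff_kwedge kscale_diff kscale_kscale kscale_kwedge
    by (simp only: mult.commute)
  then have "kscale (xmon u) (kbasis \<sigma>) - pdiff (klift u l \<sigma>) = kwedge l ?w"
    by (simp only: x diff_diff_eq2 add_diff_cancel_left')
  moreover have "?w \<in> coeffs_in J"
  proof -
    have "pdiff (kbasis \<sigma>) \<tau> \<in> (P :: ('n, 'k) mpoly set)" for \<tau>
      using pdiff_kbasis[of \<sigma>] mon_gen_mono[of "xvar ` \<sigma>" "xvar ` A"] assms
      unfolding P_def coeffs_in_def by blast
    then have "xmon (u - xvar l) * pdiff (kbasis \<sigma>) \<tau> \<in> J" for \<tau>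
      using nice unfolding P_def J_def by (blast intro: xmon_mult_variables_mem)
    then show ?thesis by (simp add: coeffs_in_def kscale_def)
  qed
  then have "kwedge l ?w \<in> coeffs_in J" unfolding J_def by (rule coeffs_in_kwedge)
  ultimately show ?thesis by (simp only:)
qed

text \<open>Multiplication by u as an injection of S/P into S/J, on chains.\<close>

lemma kscale_colon: "kscale (xmon u) a \<in> coeffs_in J \<longleftrightarrow> a \<in> coeffs_in P"
  by (simp add: coeffs_in_def kscale_def colon)

lemma pdiff_sum_klift:
  fixes c :: "'n set \<Rightarrow> 'k"
  assumes "\<And>\<sigma>. \<sigma> \<in> S \<Longrightarrow> \<sigma> \<subseteq> A"
  shows "kscale (xmon u) (\<Sum>\<sigma>\<in>S. kscale (const (c \<sigma>)) (kbasis \<sigma>)) -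
    pdiff (\<Sum>\<sigma>\<in>S. kscale (const (c \<sigma>)) (klift u l \<sigma>)) \<in> coeffs_in J"
proof -
  have "kscale (xmon u) (\<Sum>\<sigma>\<in>S. kscale (const (c \<sigma>)) (kbasis \<sigma>)) -
      pdiff (\<Sum>\<sigma>\<in>S. kscale (const (c \<sigma>)) (klift u l \<sigma>)) =
      (\<Sum>\<sigma>\<in>S. kscale (const (c \<sigma>)) (kscale (xmon u) (kbasis \<sigma>) - pdiff (klift u l \<sigma>)))"
    unfolding kscale_sum kdiff_sum kdiff_kscale kscale_commute[of "xmon u"] kscale_diff sum_subtractf ..
  also have "\<dots> \<in> coeffs_in J" unfolding J_def
    by (intro coeffs_in_sum coeffs_in_kscale pdiff_klift[unfolded J_def] assms)
  finally show ?thesis .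
qed

text \<open>The differential is u e_\<sigma> modulo J, and u vanishes in the enlarged
  quotient.\<close>

lemma klift_qcycle:
  assumes "\<sigma> \<subseteq> A" "card \<sigma> = k"
  shows "klift u l \<sigma> \<in> qcycles (mon_gen (insert u U) :: ('n, 'k) mpoly set) (Suc k)"
proof -
  let ?I = "mon_gen (insert u U) :: ('n, 'k) mpoly set"
  have "xmon u \<in> ?I" unfolding xmon_mem_mon_gen using mdvd_refl by blast
  then have "kbasis \<sigma> \<tau> * xmon u \<in> ?I" for \<tau> by (rule mon_gen_mult)
  then have "kscale (xmon u) (kbasis \<sigma>) \<in> coeffs_in ?I" by (simp add: coeffs_in_def kscale_def mult.commute)
  moreover have "kscale (xmon u) (kbasis \<sigma>) - pdiff (klift u l \<sigma>) \<in> coeffs_in ?I"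
    using pdiff_klift[OF assms(1)] mon_gen_mono[of U "insert u U"]
    unfolding J_def coeffs_in_def by blast
  ultimately have "kscale (xmon u) (kbasis \<sigma>) -
      (kscale (xmon u) (kbasis \<sigma>) - pdiff (klift u l \<sigma>)) \<in> coeffs_in ?I"
    by (rule coeffs_in_diff)
  then show ?thesis unfolding qcycles_def using kchains_klift[OF assms(2)] by simp
qed

text \<open>Chase of the connecting map. Modulo J the differential of a is u q. Here q is a cycle
  modulo P because multiplication by u is injective on S/P, hence it is homologous to a combination
  of the e_\<sigma>. Subtracting the corresponding lifts, and u h to account for the bounding chain
  h, makes a into a cycle modulo J.\<close>

lemma qcycles_insert:
  fixes a :: "'n set \<Rightarrow> ('n, 'k) mpoly"
  assumes "a \<in> qcycles (mon_gen (insert u U)) (Suc k)"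
  obtains c h where "h \<in> kchains (Suc k)"
    "a - (\<Sum>\<sigma> | \<sigma> \<subseteq> A \<and> card \<sigma> = k. kscale (const (c \<sigma>)) (klift u l \<sigma>)) - kscale (xmon u) h \<in> qcycles J (Suc k)"
proof -
  have a: "a \<in> kchains (Suc k)" "pdiff a \<in> coeffs_in (mon_gen (insert u U))"
    using assms by (simp_all add: qcycles_def)
  obtain q where q: "q \<in> kchains k" "pdiff a - kscale (xmon u) q \<in> coeffs_in J"
    using coeffs_in_insertE[OF a(2) kchains_kdiff[OF a(1)]] unfolding J_def by blast
  have "pdiff (pdiff a - kscale (xmon u) q) \<in> coeffs_in J"
    using q(2) unfolding J_def by (rule coeffs_in_kdiff)
  then have "- kscale (xmon u) (pdiff q) \<in> coeffs_in J"
    by (simp add: kdiff_diff kdiff_kscale)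
  then have "kscale (xmon u) (pdiff q) \<in> coeffs_in J"
    unfolding J_def using coeffs_in_uminus by fastforce
  then have "q \<in> qcycles P k" using q(1) by (simp add: kscale_colon qcycles_def)
  then obtain c h where h: "h \<in> kchains (Suc k)" and
    "q - (\<Sum>\<sigma> | \<sigma> \<subseteq> A \<and> card \<sigma> = k. kscale (const (c \<sigma>)) (kbasis \<sigma>)) - pdiff h \<in> coeffs_in P"
    using qcycles_variables[of q A k] unfolding P_def qbounds_def by blast
  then have 1: "kscale (xmon u) (q - (\<Sum>\<sigma> | \<sigma> \<subseteq> A \<and> card \<sigma> = k. kscale (const (c \<sigma>)) (kbasis \<sigma>)) - pdiff h) \<in> coeffs_in J"
    (is "kscale _ (q - ?e - _) \<in> _") by (simp add: kscale_colon)
  let ?z = "\<Sum>\<sigma> | \<sigma> \<subseteq> A \<and> card \<sigma> = k. kscale (const (c \<sigma>)) (klift u l \<sigma>)"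
  have "kscale (xmon u) ?e - pdiff ?z \<in> coeffs_in J" by (rule pdiff_sum_klift) simp
  \<comment> \<open>The terms u q and u \<open>?e\<close> cancel and leave the differential of the
    corrected chain.\<close>
  then have "(pdiff a - kscale (xmon u) q) + kscale (xmon u) (q - ?e - pdiff h)
      + (kscale (xmon u) ?e - pdiff ?z) \<in> coeffs_in J"
    using q(2) 1 unfolding J_def by (intro coeffs_in_add)
  also have "(pdiff a - kscale (xmon u) q) + kscale (xmon u) (q - ?e - pdiff h)
      + (kscale (xmon u) ?e - pdiff ?z) = pdiff (a - ?z - kscale (xmon u) h)"
    unfolding kdiff_diff kdiff_kscale kscale_diff by (simp add: algebra_simps)
  finally have "pdiff (a - ?z - kscale (xmon u) h) \<in> coeffs_in J" .
  moreover have "a - ?z - kscale (xmon u) h \<in> kchains (Suc k)"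
    by (intro kchains_diff kchains_sum kchains_kscale a(1) h kchains_klift) simp
  ultimately show thesis using h by (intro that) (simp_all add: qcycles_def)
qed

text \<open>This contains the injectivity of H(S/J) -> H(S/(J + (u))). Modulo J the given chain is a
  boundary plus u q. Applying the differential shows that the combination of the e_\<sigma> with
  coefficients c agrees modulo P with the differential of q, and comparing constant terms gives c =
  0. Then q is itself a cycle modulo P, and since multiplication by u is zero on homology in this
  degree, y is a boundary modulo J.\<close>

lemma qbounds_insert:
  fixes y :: "'n set \<Rightarrow> ('n, 'k) mpoly" and c :: "'n set \<Rightarrow> 'k"
  assumes y: "y \<in> qcycles J (Suc k)"
    and b: "(\<Sum>\<sigma> | \<sigma> \<subseteq> A \<and> card \<sigma> = k. kscale (const (c \<sigma>)) (klift u l \<sigma>)) + y \<in> qbounds (mon_gen (insert u U)) (Suc k)"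
  shows "\<sigma> \<subseteq> A \<Longrightarrow> card \<sigma> = k \<Longrightarrow> c \<sigma> = 0" and "y \<in> qbounds J (Suc k)"
proof -
  let ?S = "{\<sigma>. \<sigma> \<subseteq> A \<and> card \<sigma> = k}"
  let ?z = "\<Sum>\<sigma>\<in>?S. kscale (const (c \<sigma>)) (klift u l \<sigma>)" and ?e = "\<Sum>\<sigma>\<in>?S. kscale (const (c \<sigma>)) (kbasis \<sigma>) :: 'n set \<Rightarrow> ('n, 'k) mpoly"
  obtain b where b: "b \<in> kchains (Suc (Suc k))" "?z + y - pdiff b \<in> coeffs_in (mon_gen (insert u U))"
    using assms(2) by (auto simp: qbounds_def)
  have "?z + y - pdiff b \<in> kchains (Suc k)"
    using y b(1) unfolding qcycles_def
    by (intro kchains_diff kchains_add kchains_sum kchains_kscale kchains_klift kchains_kdiff) simp_all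
  then obtain q where q: "q \<in> kchains (Suc k)" "?z + y - pdiff b - kscale (xmon u) q \<in> coeffs_in J"
    using coeffs_in_insertE[OF b(2)] unfolding J_def by blast
  have 1: "kscale (xmon u) ?e - pdiff ?z \<in> coeffs_in J" by (rule pdiff_sum_klift) simp
  have 2: "pdiff (?z + y - pdiff b - kscale (xmon u) q) \<in> coeffs_in J"
    using q(2) unfolding J_def by (rule coeffs_in_kdiff)
  have 3: "pdiff y \<in> coeffs_in J" using y by (simp only: qcycles_def mem_Collect_eq)
  have "pdiff (?z + y - pdiff b - kscale (xmon u) q) + (kscale (xmon u) ?e - pdiff ?z) - pdiff y \<in> coeffs_in J"
    using coeffs_in_diff[OF coeffs_in_add[OF 2[unfolded J_def] 1[unfolded J_def]] 3[unfolded J_def]]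
    unfolding J_def .
  also have "pdiff (?z + y - pdiff b - kscale (xmon u) q) + (kscale (xmon u) ?e - pdiff ?z) - pdiff y =
      kscale (xmon u) (?e - pdiff q)"
    unfolding kdiff_diff kdiff_add kdiff_kdiff kdiff_kscale kscale_diff by (simp add: algebra_simps)
  finally have e: "?e - pdiff q \<in> coeffs_in P" by (simp add: kscale_colon)
  show c: "c \<sigma> = 0" if "\<sigma> \<subseteq> A" "card \<sigma> = k" for \<sigma>
  proof -
    have "?e \<sigma> = (\<Sum>\<rho>\<in>?S. if \<sigma> = \<rho> then const (c \<rho>) else 0)"
      unfolding sum_fun_apply by (rule sum.cong) (auto simp: kscale_def kbasis_def)
    also have "\<dots> = const (c \<sigma>)" using that by (simp add: sum.delta)
    finally have "const (c \<sigma>) - pdiff q \<sigma> \<in> P" using e by (auto simp: coeffs_in_def dest: spec[of _ \<sigma>])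
    \<comment> \<open>Elements of P have no constant term, and neither do the coefficients of a
      boundary.\<close>
    then have "lookup (const (c \<sigma>) - pdiff q \<sigma>) 0 = 0" unfolding P_def by (rule lookup_zero_variables)
    moreover have "lookup (pdiff q \<sigma>) 0 = 0" by (rule lookup_zero_variables[OF pdiff_mem_variables])
    ultimately show ?thesis by (simp add: lookup_minus const_def)
  qed
  have "?e = 0" "?z = 0"
    using c by (auto intro!: sum.neutral simp: const_def kscale_def fun_eq_iff)
  then have "pdiff q \<in> coeffs_in P" using e coeffs_in_uminus[of "- pdiff q" "xvar ` A"] unfolding P_def by simp
  then have "q \<in> qcycles P (Suc k)" using q(1) by (simp add: qcycles_def)
  then obtain d h where h: "h \<in> kchains (Suc (Suc k))" and
    "q - (\<Sum>\<sigma> | \<sigma> \<subseteq> A \<and> card \<sigma> = Suc k. kscale (const (d \<sigma>)) (kbasis \<sigma>)) - pdiff h \<in> coeffs_in P"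
    using qcycles_variables[of q A "Suc k"] unfolding P_def qbounds_def by blast
  then have 2: "kscale (xmon u) (q - (\<Sum>\<sigma> | \<sigma> \<subseteq> A \<and> card \<sigma> = Suc k. kscale (const (d \<sigma>)) (kbasis \<sigma>)) - pdiff h) \<in> coeffs_in J"
    (is "kscale _ (q - ?e' - _) \<in> _") by (simp add: kscale_colon)
  let ?z' = "\<Sum>\<sigma> | \<sigma> \<subseteq> A \<and> card \<sigma> = Suc k. kscale (const (d \<sigma>)) (klift u l \<sigma>)"
  have "kscale (xmon u) ?e' - pdiff ?z' \<in> coeffs_in J" by (rule pdiff_sum_klift) simp
  \<comment> \<open>Modulo J the decomposition of q turns u q into the differential of
    \<open>?z'\<close> plus u h.\<close>
  then have "(?z + y - pdiff b - kscale (xmon u) q) + kscale (xmon u) (q - ?e' - pdiff h)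
      + (kscale (xmon u) ?e' - pdiff ?z') \<in> coeffs_in J"
    using q(2) 2 unfolding J_def by (intro coeffs_in_add)
  also have "(?z + y - pdiff b - kscale (xmon u) q) + kscale (xmon u) (q - ?e' - pdiff h)
      + (kscale (xmon u) ?e' - pdiff ?z') = y - pdiff (b + kscale (xmon u) h + ?z')"
    unfolding \<open>?z = 0\<close> kdiff_add kdiff_kscale kscale_diff by (simp add: algebra_simps)
  finally have "y - pdiff (b + kscale (xmon u) h + ?z') \<in> coeffs_in J" .
  moreover have "b + kscale (xmon u) h + ?z' \<in> kchains (Suc (Suc k))"
    by (intro kchains_add kchains_sum kchains_kscale b(1) h kchains_klift) simp
  ultimately show "y \<in> qbounds J (Suc k)" unfolding qbounds_def by blast
qed

end

section \<open>Lists of generators\<close>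

lemma qcycles_mono:
  "U \<subseteq> V \<Longrightarrow> a \<in> qcycles (mon_gen U) k \<Longrightarrow> a \<in> qcycles (mon_gen V) k"
  using mon_gen_mono[of U V] by (auto simp only: qcycles_def coeffs_in_def mem_Collect_eq)

text \<open>The start of the induction: with \<open>A\<close> empty,
  \<open>qcycles_variables\<close> offers no \<sigma> of positive size, so the Koszul homology of S
  vanishes in positive degrees.\<close>

lemma qcycles_empty:
  assumes "a \<in> qcycles (mon_gen {}) (Suc k)"
  shows "a \<in> qbounds (mon_gen {}) (Suc k)"
proof -
  have "{\<sigma> :: 'a set. \<sigma> \<subseteq> {} \<and> card \<sigma> = Suc k} = {}" by auto
  then show ?thesis using qcycles_variables[of a "{}" "Suc k"] assms by (simp only: image_empty sum.empty diff_zero) blast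
qed

text \<open>Here \<open>A u\<close> stands for the set of \<open>u\<close> in the sense of linear quotients.\<close>

locale linear_quotient_lifts =
  fixes us :: "'n::{finite,linorder} mon list" and l :: "'n mon \<Rightarrow> 'n" and A :: "'n mon \<Rightarrow> 'n set"
  assumes dist: "distinct us"
    and dvd: "\<And>u. u \<in> set us \<Longrightarrow> mdvd (xvar (l u)) u"
    and colon: "\<And>vs u ws f. us = vs @ u # ws \<Longrightarrow>
      xmon u * f \<in> mon_gen (set vs) \<longleftrightarrow> (f :: ('n, 'k::field) mpoly) \<in> mon_gen (xvar ` A u)"
    and nice: "\<And>vs u ws t. us = vs @ u # ws \<Longrightarrow> t \<in> A u \<Longrightarrow>
      (xmon (u - xvar (l u) + xvar t) :: ('n, 'k) mpoly) \<in> mon_gen (set vs)"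
begin

text \<open>The number k is the size of \<sigma>, so the chain lies in degree
  \<open>Suc k\<close>.\<close>

definition liftsum :: "nat \<Rightarrow> 'n mon set \<Rightarrow> ('n mon \<Rightarrow> 'n set \<Rightarrow> 'k) \<Rightarrow> 'n set \<Rightarrow> ('n, 'k) mpoly" where
  "liftsum k U c = (\<Sum>u\<in>U. \<Sum>\<sigma> | \<sigma> \<subseteq> A u \<and> card \<sigma> = k. kscale (const (c u \<sigma>)) (klift u (l u) \<sigma>))"

text \<open>A lift becomes a cycle when its own generator is adjoined, and remains one modulo larger
  ideals.\<close>

lemma klift_mem_qcycles:
  assumes "us = vs @ ws" "u \<in> set vs" "\<sigma> \<subseteq> A u" "card \<sigma> = k"
  shows "klift u (l u) \<sigma> \<in> qcycles (mon_gen (set vs) :: ('n, 'k) mpoly set) (Suc k)"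
proof -
  obtain xs ys where v: "vs = xs @ u # ys" using assms(2) by (meson split_list)
  then have e: "us = xs @ u # (ys @ ws)" using assms(1) by simp
  have "u \<in> set us" using e by simp
  from klift_qcycle[OF dvd[OF this] colon[OF e] nice[OF e] assms(3,4)]
  have "klift u (l u) \<sigma> \<in> qcycles (mon_gen (insert u (set xs)) :: ('n, 'k) mpoly set) (Suc k)" .
  then show ?thesis by (rule qcycles_mono[rotated]) (use v in auto)
qed

lemma liftsum_mem_qcycles:
  assumes "us = vs @ ws"
  shows "liftsum k (set vs) c \<in> qcycles (mon_gen (set vs)) (Suc k)"
proof -
  have *: "(klift u (l u) \<sigma> :: 'n set \<Rightarrow> ('n, 'k) mpoly) \<in> kchains (Suc k) \<and> pdiff (klift u (l u) \<sigma>) \<in> coeffs_in (mon_gen (set vs) :: ('n, 'k) mpoly set)"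
    if "u \<in> set vs" "\<sigma> \<subseteq> A u" "card \<sigma> = k" for u \<sigma>
    using klift_mem_qcycles[OF assms that] by (simp only: qcycles_def mem_Collect_eq)
  have "liftsum k (set vs) c \<in> kchains (Suc k)"
    unfolding liftsum_def using * by (intro kchains_sum kchains_kscale) auto
  moreover have "pdiff (liftsum k (set vs) c) \<in> coeffs_in (mon_gen (set vs))"
    unfolding liftsum_def kdiff_sum kdiff_kscale using *
    by (intro coeffs_in_sum coeffs_in_kscale) auto
  ultimately show ?thesis by (simp only: qcycles_def mem_Collect_eq)
qed

lemma liftsum_snoc:
  assumes "us = (vs @ [u]) @ ws"
  shows "liftsum k (set (vs @ [u])) c =
    (\<Sum>\<sigma> | \<sigma> \<subseteq> A u \<and> card \<sigma> = k. kscale (const (c u \<sigma>)) (klift u (l u) \<sigma>)) + liftsum k (set vs) c"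
proof -
  have "u \<notin> set vs" using dist assms by auto
  moreover have "set (vs @ [u]) = insert u (set vs)" by auto
  ultimately show ?thesis unfolding liftsum_def by (simp only: sum.insert finite_set not_False_eq_True)
qed

text \<open>Induction from the last generator: \<open>qcycles_insert\<close> splits off its lifts
  and leaves a cycle modulo the smaller ideal, to which the induction hypothesis applies.\<close>

lemma liftsum_spans:
  assumes "us = vs @ ws" and "a \<in> qcycles (mon_gen (set vs)) (Suc k)"
  shows "\<exists>c. a - liftsum k (set vs) c \<in> qbounds (mon_gen (set vs)) (Suc k)"
  using assms
proof (induction vs arbitrary: ws a rule: rev_induct)
  case Nil
  then have "a - liftsum k (set []) c \<in> qbounds (mon_gen (set [])) (Suc k)" for c
    unfolding liftsum_def list.set sum.empty diff_zero by (intro qcycles_empty)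
  then show ?case by (rule exI)
next
  case (snoc u vs)
  let ?J = "mon_gen (set vs) :: ('n, 'k) mpoly set" and ?I = "mon_gen (set (vs @ [u])) :: ('n, 'k) mpoly set"
  have e: "us = vs @ u # ws" using snoc.prems(1) by simp
  have u: "u \<in> set us" using e by simp
  have i: "set (vs @ [u]) = insert u (set vs)" by auto
  have a: "a \<in> qcycles (mon_gen (insert u (set vs))) (Suc k)" using snoc.prems(2) unfolding i .
  obtain c h where h: "h \<in> kchains (Suc k)" and
    c: "a - (\<Sum>\<sigma> | \<sigma> \<subseteq> A u \<and> card \<sigma> = k. kscale (const (c \<sigma>)) (klift u (l u) \<sigma>)) - kscale (xmon u) h \<in> qcycles ?J (Suc k)"
    (is "a - ?z - _ \<in> _")
    by (rule qcycles_insert[OF dvd[OF u] colon[OF e] nice[OF e] a])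
  obtain d where "a - ?z - kscale (xmon u) h - liftsum k (set vs) d \<in> qbounds ?J (Suc k)"
    using snoc.IH[OF e c] by blast
  then obtain b where b: "b \<in> kchains (Suc (Suc k))"
    "a - ?z - kscale (xmon u) h - liftsum k (set vs) d - pdiff b \<in> coeffs_in ?J"
    unfolding qbounds_def by blast
  \<comment> \<open>As u does not occur in \<open>vs\<close>, overriding \<open>d\<close> at u
    leaves the sum over \<open>vs\<close> unchanged.\<close>
  let ?c = "d(u := c)"
  have "liftsum k (set vs) ?c = liftsum k (set vs) d"
    unfolding liftsum_def using dist e by (intro sum.cong refl) auto
  then have s: "liftsum k (set (vs @ [u])) ?c = ?z + liftsum k (set vs) d"
    unfolding liftsum_snoc[OF snoc.prems(1)] by (simp only: fun_upd_same)
  \<comment> \<open>The correction u h disappears modulo the ideal that contains u.\<close>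
  have "h \<tau> * xmon u \<in> ?I" for \<tau>
    by (rule mon_gen_mult) (use mdvd_refl in \<open>auto simp: xmon_mem_mon_gen\<close>)
  then have "kscale (xmon u) h \<in> coeffs_in ?I" by (simp add: coeffs_in_def kscale_def mult.commute)
  moreover have "a - ?z - kscale (xmon u) h - liftsum k (set vs) d - pdiff b \<in> coeffs_in ?I"
    using b(2) mon_gen_mono[of "set vs" "set (vs @ [u])"] unfolding coeffs_in_def i by blast
  ultimately have "kscale (xmon u) h + (a - ?z - kscale (xmon u) h - liftsum k (set vs) d - pdiff b) \<in> coeffs_in ?I"
    by (rule coeffs_in_add)
  also have "kscale (xmon u) h + (a - ?z - kscale (xmon u) h - liftsum k (set vs) d - pdiff b) =
      a - liftsum k (set (vs @ [u])) ?c - pdiff b"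
    unfolding s by (simp only: algebra_simps) 
  finally have "a - liftsum k (set (vs @ [u])) ?c \<in> qbounds ?I (Suc k)"
    unfolding qbounds_def using b(1) by (intro CollectI bexI[of _ b])
  then show ?case by (rule exI[of _ ?c])
qed

text \<open>\<open>qbounds_insert\<close> settles the last generator: its coefficients vanish, and
  the remaining sum is still a boundary modulo the smaller ideal, ready for the induction
  hypothesis.\<close>

lemma liftsum_independent:
  assumes "us = vs @ ws" and "liftsum k (set vs) c \<in> qbounds (mon_gen (set vs)) (Suc k)"
    and "u \<in> set vs" "\<sigma> \<subseteq> A u" "card \<sigma> = k"
  shows "c u \<sigma> = 0"
  using assms
proof (induction vs arbitrary: ws u \<sigma> rule: rev_induct)
  case Nil
  then show ?case by simp
next
  case (snoc v vs)
  have e: "us = vs @ v # ws" using snoc.prems(1) by simp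
  have v: "v \<in> set us" using e by simp
  have i: "set (vs @ [v]) = insert v (set vs)" by auto
  have b: "(\<Sum>\<sigma> | \<sigma> \<subseteq> A v \<and> card \<sigma> = k. kscale (const (c v \<sigma>)) (klift v (l v) \<sigma>)) + liftsum k (set vs) c
      \<in> qbounds (mon_gen (insert v (set vs))) (Suc k)"
    using snoc.prems(2)[unfolded liftsum_snoc[OF snoc.prems(1)]] unfolding i .
  note q = qbounds_insert[OF dvd[OF v] colon[OF e] nice[OF e] liftsum_mem_qcycles[OF e] b]
  show ?case
  proof (cases "u = v")
    case True
    then show ?thesis using q(1) snoc.prems(4,5) by blast
  next
    case False
    then have "u \<in> set vs" using snoc.prems(3) by simp
    then show ?thesis using snoc.IH[OF e q(2)] snoc.prems(4,5) by blast
  qed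
qed

end

section \<open>Koszul homology of the quotient ring\<close>

lemma vectorspace_image:
  fixes H :: "('k::field, 'h, 'm) module_scheme" and \<Phi> :: "'v::ab_group_add \<Rightarrow> 'h"
  assumes vs: "Vector_Spaces.vector_space s"
    and V: "0 \<in> V" "\<And>v w. v \<in> V \<Longrightarrow> w \<in> V \<Longrightarrow> v + w \<in> V" "\<And>c v. v \<in> V \<Longrightarrow> s c v \<in> V"
    and carrier: "carrier H = \<Phi> ` V"
    and zero: "\<zero>\<^bsub>H\<^esub> = \<Phi> 0"
    and add: "\<And>v w. v \<in> V \<Longrightarrow> w \<in> V \<Longrightarrow> \<Phi> v \<oplus>\<^bsub>H\<^esub> \<Phi> w = \<Phi> (v + w)"
    and smult: "\<And>c v. v \<in> V \<Longrightarrow> c \<odot>\<^bsub>H\<^esub> \<Phi> v = \<Phi> (s c v)"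
  shows "vectorspace field_ring H"
proof -
  interpret s: Vector_Spaces.vector_space s by (rule vs)
  have "module field_ring H"
  proof (rule module_criteria)
    show "\<forall>v\<in>carrier H. \<exists>neg_v\<in>carrier H. v \<oplus>\<^bsub>H\<^esub> neg_v = \<zero>\<^bsub>H\<^esub>"
    proof
      fix v assume "v \<in> carrier H"
      then obtain a where a: "a \<in> V" "v = \<Phi> a" using carrier by blast
      have "v \<oplus>\<^bsub>H\<^esub> \<Phi> (s (-1) a) = \<zero>\<^bsub>H\<^esub>"
        using a V(3)[of a "-1"] by (simp add: add zero)
      then show "\<exists>neg_v\<in>carrier H. v \<oplus>\<^bsub>H\<^esub> neg_v = \<zero>\<^bsub>H\<^esub>"
        using V(3)[OF a(1)] carrier by blast
    qed
  qed (auto simp: carrier zero add smult V ring_of_type_algebra_ops add_ac s.scale_left_distrib s.scale_right_distrib)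
  then show ?thesis by (simp add: vectorspace_def field_from_type_algebra)
qed

text \<open>Applied with V the cycles over S and \<Phi> the map to homology, this reduces a claim
  about cosets to spanning and independence modulo the kernel of \<Phi>. Independence is required of
  the indexed family, hence it also yields injectivity.\<close>

lemma basis_image:
  fixes H :: "('k::field, 'h, 'm) module_scheme" and \<Phi> :: "'v::ab_group_add \<Rightarrow> 'h" and z :: "'i \<Rightarrow> 'v"
  assumes vs: "Vector_Spaces.vector_space s"
    and V: "0 \<in> V" "\<And>v w. v \<in> V \<Longrightarrow> w \<in> V \<Longrightarrow> v + w \<in> V" "\<And>c v. v \<in> V \<Longrightarrow> s c v \<in> V"
    and carrier: "carrier H = \<Phi> ` V"
    and zero: "\<zero>\<^bsub>H\<^esub> = \<Phi> 0"
    and add: "\<And>v w. v \<in> V \<Longrightarrow> w \<in> V \<Longrightarrow> \<Phi> v \<oplus>\<^bsub>H\<^esub> \<Phi> w = \<Phi> (v + w)"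
    and smult: "\<And>c v. v \<in> V \<Longrightarrow> c \<odot>\<^bsub>H\<^esub> \<Phi> v = \<Phi> (s c v)"
    and fin: "finite B" and z: "\<And>p. p \<in> B \<Longrightarrow> z p \<in> V"
    and span: "\<And>v. v \<in> V \<Longrightarrow> \<exists>c. \<Phi> v = \<Phi> (\<Sum>p\<in>B. s (c p) (z p))"
    and indep: "\<And>c. \<Phi> (\<Sum>p\<in>B. s (c p) (z p)) = \<Phi> 0 \<Longrightarrow> \<forall>p\<in>B. c p = 0"
  shows "inj_on (\<lambda>p. \<Phi> (z p)) B" and "vectorspace.basis field_ring H ((\<lambda>p. \<Phi> (z p)) ` B)"
proof -
  interpret s: Vector_Spaces.vector_space s by (rule vs)
  interpret H: vectorspace field_ring H by (rule vectorspace_image[OF vs V carrier zero add smult])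
  have sumV: "(\<Sum>p\<in>T. s (c p) (z p)) \<in> V" if "T \<subseteq> B" for T c
    using finite_subset[OF that fin] that by induction (auto intro: V z)
  have hom: "(\<Oplus>\<^bsub>H\<^esub>p\<in>T. c p \<odot>\<^bsub>H\<^esub> \<Phi> (z p)) = \<Phi> (\<Sum>p\<in>T. s (c p) (z p))" if "T \<subseteq> B" for T c
    using finite_subset[OF that fin] that
  proof induction
    case empty
    then show ?case by (simp add: zero)
  next
    case (insert p T)
    have cl: "c q \<odot>\<^bsub>H\<^esub> \<Phi> (z q) \<in> carrier H" if "q \<in> B" for q
      using that by (simp add: smult z V carrier)
    have "(\<Oplus>\<^bsub>H\<^esub>p\<in>insert p T. c p \<odot>\<^bsub>H\<^esub> \<Phi> (z p)) = c p \<odot>\<^bsub>H\<^esub> \<Phi> (z p) \<oplus>\<^bsub>H\<^esub> (\<Oplus>\<^bsub>H\<^esub>p\<in>T. c p \<odot>\<^bsub>H\<^esub> \<Phi> (z p))"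
      by (rule H.finsum_insert) (use insert cl in auto)
    also have "\<dots> = \<Phi> (s (c p) (z p)) \<oplus>\<^bsub>H\<^esub> \<Phi> (\<Sum>p\<in>T. s (c p) (z p))"
      using insert by (simp add: smult z)
    also have "\<dots> = \<Phi> (\<Sum>p\<in>insert p T. s (c p) (z p))"
      using insert sumV[of T c] by (simp add: add V z)
    finally show ?case .
  qed
  show inj: "inj_on (\<lambda>p. \<Phi> (z p)) B"
  proof (rule inj_onI, rule ccontr)
    fix p q assume pq: "p \<in> B" "q \<in> B" "\<Phi> (z p) = \<Phi> (z q)" "p \<noteq> q"
    \<comment> \<open>Two equal images would give the nontrivial relation with coefficients 1 at p
      and -1 at q.\<close>
    define c where "c r = (if r = p then 1 else if r = q then -1 else (0 :: 'k))" for r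
    have "(\<Sum>r\<in>B. s (c r) (z r)) = (\<Sum>r\<in>{p, q}. s (c r) (z r))"
      by (rule sum.mono_neutral_right) (use fin pq in \<open>auto simp: c_def\<close>)
    also have "\<dots> = z p + s (-1) (z q)" using pq(4) by (simp add: c_def)
    finally have "\<Phi> (\<Sum>r\<in>B. s (c r) (z r)) = \<Phi> (z p + s (-1) (z q))" by (rule arg_cong)
    also have "\<dots> = \<Phi> (z p) \<oplus>\<^bsub>H\<^esub> \<Phi> (s (-1) (z q))" using z[OF pq(1)] V(3)[OF z[OF pq(2)]] by (rule add[symmetric])
    also have "\<dots> = \<Phi> (z q + s (-1) (z q))" unfolding pq(3) using z[OF pq(2)] V(3)[OF z[OF pq(2)]] by (rule add)
    also have "\<dots> = \<Phi> 0" by simp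
    finally have "\<forall>p\<in>B. c p = 0" by (rule indep)
    then have "c p = 0" using pq(1) by blast
    then show False by (simp add: c_def)
  qed
  have sub: "(\<lambda>p. \<Phi> (z p)) ` B \<subseteq> carrier H" using z by (auto simp: carrier)
  have lc: "H.lincomb a ((\<lambda>p. \<Phi> (z p)) ` B) = \<Phi> (\<Sum>p\<in>B. s (a (\<Phi> (z p))) (z p))" for a
    unfolding H.lincomb_def
    by (subst H.add.finprod_reindex[OF _ inj]) (use hom[OF subset_refl, of "\<lambda>p. a (\<Phi> (z p))"] z in \<open>auto simp: smult carrier V\<close>)
  have "H.lin_indpt ((\<lambda>p. \<Phi> (z p)) ` B)"
  proof (rule H.finite_lin_indpt2)
    fix a assume "H.lincomb a ((\<lambda>p. \<Phi> (z p)) ` B) = \<zero>\<^bsub>H\<^esub>"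
    then have "\<Phi> (\<Sum>p\<in>B. s (a (\<Phi> (z p))) (z p)) = \<Phi> 0" by (simp only: lc zero)
    then show "\<forall>v\<in>(\<lambda>p. \<Phi> (z p)) ` B. a v = \<zero>\<^bsub>field_ring\<^esub>"
      using indep[of "\<lambda>p. a (\<Phi> (z p))"] by (auto simp: ring_of_type_algebra_ops)
  qed (use fin sub in auto)
  moreover have "H.span ((\<lambda>p. \<Phi> (z p)) ` B) = carrier H"
  proof
    show "H.span ((\<lambda>p. \<Phi> (z p)) ` B) \<subseteq> carrier H" using sub by (rule H.span_is_subset2)
    show "carrier H \<subseteq> H.span ((\<lambda>p. \<Phi> (z p)) ` B)"
    proof
      fix w assume "w \<in> carrier H"
      then obtain v where v: "v \<in> V" "w = \<Phi> v" using carrier by blast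
      obtain c where c: "\<Phi> v = \<Phi> (\<Sum>p\<in>B. s (c p) (z p))" using span[OF v(1)] by blast
      \<comment> \<open>Linear combinations in \<open>H\<close> take coefficients indexed by
        vectors; injectivity allows the index to be recovered from the vector.\<close>
      define a where "a h = c (inv_into B (\<lambda>p. \<Phi> (z p)) h)" for h
      have "a (\<Phi> (z p)) = c p" if "p \<in> B" for p
        unfolding a_def using inv_into_f_f[OF inj that] by simp
      then have "w = H.lincomb a ((\<lambda>p. \<Phi> (z p)) ` B)"
        unfolding lc v(2) c by (simp cong: sum.cong)
      then show "w \<in> H.span ((\<lambda>p. \<Phi> (z p)) ` B)"
        unfolding H.span_def using fin by (auto simp: ring_of_type_algebra_ops)
    qed
  qed
  ultimately show "H.basis ((\<lambda>p. \<Phi> (z p)) ` B)" using sub by (simp only: H.basis_def simp_thms)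
qed

lemma (in ring_hom_cring) koszul_diff_hom:
  fixes x :: "'n::{finite,linorder} \<Rightarrow> 'a"
  assumes "x \<in> UNIV \<rightarrow> carrier R" and "a \<in> UNIV \<rightarrow> carrier R"
  shows "koszul_diff S (\<lambda>i. h (x i)) (\<lambda>\<tau>. h (a \<tau>)) = (\<lambda>\<tau>. h (koszul_diff R x a \<tau>))"
proof
  fix \<tau> :: "'n set"
  have c: "x i \<in> carrier R" "a \<sigma> \<in> carrier R" for i \<sigma> using assms by auto
  have sgn: "h (ext_sign R {i} \<tau>) = ext_sign S {i} \<tau>" for i
    by (simp add: ext_sign_def)
  have "h (koszul_diff R x a \<tau>) = (\<Oplus>\<^bsub>S\<^esub>i\<in>-\<tau>. h (ext_sign R {i} \<tau> \<otimes> (x i \<otimes> a (insert i \<tau>))))"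
    unfolding koszul_diff_def by (subst hom_finsum) (auto simp: c R.ext_sign_closed comp_def)
  also have "\<dots> = koszul_diff S (\<lambda>i. h (x i)) (\<lambda>\<tau>. h (a \<tau>)) \<tau>"
    unfolding koszul_diff_def by (rule S.add.finprod_cong') (auto simp: c R.ext_sign_closed S.ext_sign_closed sgn)
  finally show "koszul_diff S (\<lambda>i. h (x i)) (\<lambda>\<tau>. h (a \<tau>)) \<tau> = h (koszul_diff R x a \<tau>)" by simp
qed

section \<open>Comparison of chains over S with chains over S/I\<close>

context
  fixes I :: "('n::{finite,linorder}, 'k::field) mpoly set" and U :: "'n mon set"
  assumes I: "I = mon_gen U"
begin

lemma ideal_I: "ideal I mpoly_ring"
  unfolding I by (rule ideal_mon_gen)

lemma bar_hom: "ring_hom_cring mpoly_ring (qring I) (bar I)"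
  using ideal.rcos_ring_hom_cring[OF ideal_I cring_from_type_algebra]
  by (simp add: bar_def[abs_def])

lemma bar_eq_iff: "bar I f = bar I g \<longleftrightarrow> f - g \<in> I"
proof -
  interpret cring "mpoly_ring :: ('n, 'k) mpoly ring" by (rule cring_from_type_algebra)
  show ?thesis
    using quotient_eq_iff_same_a_r_cos[OF ideal_I, of f g]
    by (simp add: bar_def minus_eq a_inv_ring_of_type_algebra ring_of_type_algebra_ops)
qed

lemma bar_ops:
  "bar I (f + g) = bar I f \<oplus>\<^bsub>qring I\<^esub> bar I g" "bar I (f * g) = bar I f \<otimes>\<^bsub>qring I\<^esub> bar I g"
  "bar I 0 = \<zero>\<^bsub>qring I\<^esub>" "bar I 1 = \<one>\<^bsub>qring I\<^esub>"
proof -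
  interpret ring_hom_cring mpoly_ring "qring I" "bar I" by (rule bar_hom)
  show "bar I (f + g) = bar I f \<oplus>\<^bsub>qring I\<^esub> bar I g" "bar I (f * g) = bar I f \<otimes>\<^bsub>qring I\<^esub> bar I g"
    "bar I 0 = \<zero>\<^bsub>qring I\<^esub>" "bar I 1 = \<one>\<^bsub>qring I\<^esub>"
    using hom_add[of f g] hom_mult[of f g] hom_zero hom_one by (simp_all only: ring_of_type_algebra_ops UNIV_I simp_thms)
qed

lemma carrier_qring: "carrier (qring I) = range (bar I)"
  by (auto simp: FactRing_def A_RCOSETS_defs a_r_coset_def bar_def ring_of_type_algebra_ops)

definition kbar :: "('n set \<Rightarrow> ('n, 'k) mpoly) \<Rightarrow> 'n set \<Rightarrow> ('n, 'k) mpoly set" where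
  "kbar a = (\<lambda>\<tau>. bar I (a \<tau>))"

lemma kbar_eq_iff: "kbar a = kbar b \<longleftrightarrow> a - b \<in> coeffs_in I"
  by (simp add: kbar_def fun_eq_iff bar_eq_iff coeffs_in_def)

lemma kbar_pdiff: "koszul_diff (qring I) (qvar I) (kbar a) = kbar (pdiff a)"
proof -
  interpret ring_hom_cring mpoly_ring "qring I" "bar I" by (rule bar_hom)
  have "koszul_diff (qring I) (qvar I) (kbar a) = (\<lambda>\<tau>. bar I (koszul_diff mpoly_ring (\<lambda>i. xmon (xvar i)) a \<tau>))"
    using koszul_diff_hom[of "\<lambda>i. xmon (xvar i)" a]
    unfolding qvar_def[abs_def] kbar_def by (simp only: ring_of_type_algebra_ops UNIV_I Pi_UNIV simp_thms)
  then show ?thesis by (simp only: koszul_diff_ring_of_type_algebra kbar_def)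
qed

lemma kbar_add: "kbar a \<oplus>\<^bsub>exterior_algebra (qring I)\<^esub> kbar b = kbar (a + b)"
  by (simp add: exterior_algebra_def kbar_def bar_ops)

lemma kbar_kscale: "bar I f \<odot>\<^bsub>exterior_algebra (qring I)\<^esub> kbar a = kbar (kscale f a)"
  by (simp add: exterior_algebra_def kbar_def bar_ops kscale_def)

lemma lift_cycle_eq_kbar: "lift_cycle I u j \<sigma> = kbar (klift u j \<sigma>)"
proof -
  interpret ring_hom_cring mpoly_ring "qring I" "bar I" by (rule bar_hom)
  have b: "ext_basis (qring I) \<sigma> \<in> carrier (exterior_algebra (qring I))"
    by (simp add: exterior_algebra_def ext_basis_def)
  have sgn: "bar I (ksign j \<tau>) = ext_sign (qring I) {j} \<tau>" for \<tau>
    unfolding ext_sign_ring_of_type_algebra[symmetric] by (simp add: ext_sign_def)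
  have e: "ext_basis (qring I) \<sigma> \<rho> = bar I (kbasis \<sigma> \<rho>)" for \<rho>
    by (simp add: ext_basis_def kbasis_def bar_ops)
  have "ext_basis (qring I) {j} \<otimes>\<^bsub>exterior_algebra (qring I)\<^esub> ext_basis (qring I) \<sigma> = kbar (kwedge j (kbasis \<sigma>))"
  proof (rule ext)
    fix \<rho>
    show "(ext_basis (qring I) {j} \<otimes>\<^bsub>exterior_algebra (qring I)\<^esub> ext_basis (qring I) \<sigma>) \<rho> =
        kbar (kwedge j (kbasis \<sigma>)) \<rho>"
      unfolding S.ext_basis_wedge[OF b] e kbar_def kwedge_def
      by (cases "j \<in> \<rho>") (simp_all only: if_True if_False bar_ops sgn)
  qed
  then show ?thesis unfolding lift_cycle_def klift_def kbar_kscale[symmetric] by (simp only:)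
qed

lemma kbar_zero: "kbar 0 = \<zero>\<^bsub>exterior_algebra (qring I)\<^esub>"
  by (simp add: exterior_algebra_def kbar_def bar_ops)

lemma koszul_chains_eq: "koszul_chains (qring I) k = kbar ` kchains k"
proof (intro equalityI subsetI)
  fix a :: "'n set \<Rightarrow> ('n, 'k) mpoly set" assume a: "a \<in> koszul_chains (qring I) k"
  then have "a \<tau> \<in> range (bar I)" for \<tau> :: "'n set"
    by (simp only: koszul_chains_def exterior_algebra_def carrier_qring[symmetric] Pi_iff
        partial_object.select_convs mem_Collect_eq UNIV_I)
  then have "\<exists>f. a \<tau> = bar I f" for \<tau> :: "'n set" by blast
  then obtain f where f: "a \<tau> = bar I (f \<tau>)" for \<tau> by metis
  \<comment> \<open>Components outside degree k are lifted to 0, so that the lift is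
    homogeneous.\<close>
  define b where "b \<tau> = (if card \<tau> = k then f \<tau> else 0)" for \<tau>
  have "a = kbar b"
  proof (rule ext)
    fix \<tau>
    show "a \<tau> = kbar b \<tau>"
      using a f[of \<tau>] unfolding koszul_chains_def kbar_def b_def by (cases "card \<tau> = k") (auto simp: bar_ops)
  qed
  moreover have "b \<in> kchains k" by (simp add: kchains_def b_def)
  ultimately show "a \<in> kbar ` kchains k" by blast
next
  fix a :: "'n set \<Rightarrow> ('n, 'k) mpoly set" assume "a \<in> kbar ` kchains k"
  then show "a \<in> koszul_chains (qring I) k"
    by (auto simp: koszul_chains_def exterior_algebra_def kbar_def kchains_def carrier_qring bar_ops)
qed

lemma koszul_cycles_eq: "koszul_cycles (qring I) (qvar I) k = kbar ` qcycles I k"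
proof -
  have "kbar (pdiff a) = \<zero>\<^bsub>exterior_algebra (qring I)\<^esub> \<longleftrightarrow> pdiff a \<in> coeffs_in I" for a
    unfolding kbar_zero[symmetric] kbar_eq_iff by simp
  then show ?thesis unfolding koszul_cycles_def koszul_chains_eq qcycles_def
    by (auto simp only: kbar_pdiff mem_Collect_eq image_iff)
qed

lemma koszul_boundaries_eq: "koszul_boundaries (qring I) (qvar I) k = (\<lambda>b. kbar (pdiff b)) ` kchains (Suc k)"
  unfolding koszul_boundaries_def koszul_chains_eq image_image kbar_pdiff ..

lemma koszul_class_kbar:
  "koszul_class (qring I) (qvar I) k (kbar a) = (\<lambda>b. kbar (pdiff b + a)) ` kchains (Suc k)"
  unfolding koszul_class_def koszul_boundaries_eq a_r_coset_def' by (auto simp only: kbar_add image_iff UN_iff)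

text \<open>The map used as \<Phi> in \<open>basis_image\<close>; it is defined on all chains over
  S, not only on cycles.\<close>

definition kclass :: "nat \<Rightarrow> ('n set \<Rightarrow> ('n, 'k) mpoly) \<Rightarrow> ('n set \<Rightarrow> ('n, 'k) mpoly set) set" where
  "kclass k a = koszul_class (qring I) (qvar I) k (kbar a)"

lemma kclass_eq: "kclass k a = (\<lambda>b. kbar (pdiff b + a)) ` kchains (Suc k)"
  unfolding kclass_def koszul_class_kbar ..

lemma kclass_mono:
  assumes "a - b \<in> qbounds I k"
  shows "kclass k a \<subseteq> kclass k b"
proof -
  obtain c where c: "c \<in> kchains (Suc k)" "a - b - pdiff c \<in> coeffs_in I"
    using assms unfolding qbounds_def by blast
  have "kbar (pdiff d + a) = kbar (pdiff (d + c) + b)" for d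
  proof -
    have "pdiff d + a - (pdiff (d + c) + b) = a - b - pdiff c"
      unfolding kdiff_add by (simp only: algebra_simps)
    then show ?thesis unfolding kbar_eq_iff using c(2) by (simp only:)
  qed
  then show ?thesis unfolding kclass_eq using kchains_add[OF _ c(1)] by blast
qed

lemma qbounds_diff_commute: "a - b \<in> qbounds I k \<Longrightarrow> b - a \<in> qbounds I k"
proof -
  assume "a - b \<in> qbounds I k"
  then obtain c where c: "c \<in> kchains (Suc k)" "a - b - pdiff c \<in> coeffs_in I"
    unfolding qbounds_def by blast
  have "b - a - pdiff (- c) = - (a - b - pdiff c)" unfolding kdiff_uminus by (simp add: algebra_simps)
  then have "b - a - pdiff (- c) \<in> coeffs_in I"
    using coeffs_in_uminus[OF c(2)[unfolded I]] by (simp only: I)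
  moreover have "- c \<in> kchains (Suc k)" using kchains_diff[OF kchains_zero c(1)] by simp
  ultimately show ?thesis unfolding qbounds_def by blast
qed

text \<open>Identifies the kernel of the map to homology, so that relations between classes become
  statements about chains over S. A class contains its representative, as 0 is a boundary, and
  equality of classes then yields the bounding chain.\<close>

lemma kclass_eq_iff: "kclass k a = kclass k b \<longleftrightarrow> a - b \<in> qbounds I k"
proof
  assume "kclass k a = kclass k b"
  moreover have "kbar a \<in> kclass k a" unfolding kclass_eq
    by (rule image_eqI[of _ _ 0]) (simp_all only: kdiff_zero add_0 kchains_zero)
  ultimately obtain c where c: "c \<in> kchains (Suc k)" "kbar a = kbar (pdiff c + b)"
    unfolding kclass_eq by blast
  then have "a - b - pdiff c \<in> coeffs_in I" unfolding kbar_eq_iff by (simp only: diff_diff_eq add.commute)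
  then show "a - b \<in> qbounds I k" unfolding qbounds_def using c(1) by blast
next
  assume "a - b \<in> qbounds I k"
  then show "kclass k a = kclass k b" using kclass_mono qbounds_diff_commute by blast
qed

lemma kclass_zero: "koszul_boundaries (qring I) (qvar I) k = kclass k 0"
  unfolding koszul_boundaries_eq kclass_eq by (simp only: add_0_right)

lemma kclass_add: "kclass k a <+>\<^bsub>exterior_algebra (qring I)\<^esub> kclass k b = kclass k (a + b)"
proof (intro equalityI subsetI)
  fix x assume "x \<in> kclass k a <+>\<^bsub>exterior_algebra (qring I)\<^esub> kclass k b"
  then obtain p q where "p \<in> kclass k a" "q \<in> kclass k b" "x = p \<oplus>\<^bsub>exterior_algebra (qring I)\<^esub> q"
    unfolding set_add_def' UN_iff singleton_iff by (elim bexE)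
  then obtain c d where c: "c \<in> kchains (Suc k)" "d \<in> kchains (Suc k)" "x = kbar (pdiff c + a + (pdiff d + b))"
    unfolding kclass_eq by (elim imageE) (simp only: kbar_add)
  have "pdiff c + a + (pdiff d + b) = pdiff (c + d) + (a + b)"
    unfolding kdiff_add by (simp only: add_ac)
  then show "x \<in> kclass k (a + b)"
    unfolding kclass_eq c(3) using kchains_add[OF c(1,2)] by (intro image_eqI[of _ _ "c + d"]) (simp_all only:)
next
  fix x assume "x \<in> kclass k (a + b)"
  then obtain c where c: "c \<in> kchains (Suc k)" "x = kbar (pdiff c + (a + b))" unfolding kclass_eq by blast
  have "x = kbar (pdiff c + a) \<oplus>\<^bsub>exterior_algebra (qring I)\<^esub> kbar (pdiff 0 + b)"
    unfolding c(2) kbar_add by (simp only: kdiff_zero add_0 add.assoc)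
  moreover have "kbar (pdiff c + a) \<in> kclass k a" unfolding kclass_eq using c(1) by (rule imageI)
  moreover have "kbar (pdiff 0 + b) \<in> kclass k b" unfolding kclass_eq using kchains_zero by (rule imageI)
  ultimately show "x \<in> kclass k a <+>\<^bsub>exterior_algebra (qring I)\<^esub> kclass k b"
    unfolding set_add_def' UN_iff singleton_iff by (intro bexI)
qed

text \<open>\<open>koszul_homology\<close> defines scalar multiplication as a union over all
  representatives. Each of them yields the same coset, and there is at least one.\<close>

lemma kclass_kscale:
  "(\<Union>z\<in>kclass k a. koszul_class (qring I) (qvar I) k (bar I f \<odot>\<^bsub>exterior_algebra (qring I)\<^esub> z)) = kclass k (kscale f a)"
proof -
  have "koszul_class (qring I) (qvar I) k (bar I f \<odot>\<^bsub>exterior_algebra (qring I)\<^esub> kbar (pdiff b + a)) = kclass k (kscale f a)"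
    if b: "b \<in> kchains (Suc k)" for b
  proof -
    have "kscale f (pdiff b + a) - kscale f a - pdiff (kscale f b) = 0"
      unfolding kscale_add kdiff_kscale by simp
    then have "kscale f (pdiff b + a) - kscale f a - pdiff (kscale f b) \<in> coeffs_in I"
      unfolding I by (simp only: coeffs_in_zero)
    then have "kscale f (pdiff b + a) - kscale f a \<in> qbounds I k"
      unfolding qbounds_def using kchains_kscale[OF b] by (intro CollectI bexI)
    then show ?thesis unfolding kbar_kscale kclass_def[symmetric] by (simp only: kclass_eq_iff)
  qed
  moreover have "kchains (Suc k) \<noteq> ({} :: ('n set \<Rightarrow> ('n, 'k) mpoly) set)" using kchains_zero by blast
  ultimately show ?thesis unfolding kclass_eq[of k a] by (simp only: UN_simps UN_constant if_False cong: SUP_cong)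
qed

end

section \<open>Linear quotients and nice Koszul lifts\<close>

text \<open>In a list without repetitions u has just one position, so the existential quantifier in
  \<open>lq_set\<close> can only select the generators before that position.\<close>

lemma mem_lq_set_iff:
  assumes "distinct us" "us = vs @ u # ws"
  shows "s \<in> lq_set TYPE('k::field) us u \<longleftrightarrow>
    (xmon (xvar s) :: ('n, 'k) mpoly) * xmon u \<in> mon_gen (set vs)"
proof -
  let ?P = "\<lambda>j. (xmon (xvar s) :: ('n, 'k) mpoly) \<in> colon (mon_gen (set (take j us))) (xmon u)"
  have j: "(j < length us \<and> us ! j = u) \<longleftrightarrow> j = length vs" for j
    using assms nth_eq_iff_index_eq[of us j "length vs"] by auto
  have "s \<in> lq_set TYPE('k) us u \<longleftrightarrow> (\<exists>j. (j < length us \<and> us ! j = u) \<and> ?P j)"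
    by (simp only: lq_set_def mem_Collect_eq conj_assoc)
  also have "\<dots> \<longleftrightarrow> ?P (length vs)" unfolding j by (simp only: simp_thms)
  finally show ?thesis using assms(2) by (simp add: colon_def)
qed

text \<open>Linear quotients only provide some set of variables generating the colon ideal. It must
  be \<open>lq_set\<close>, because a variable lies in an ideal generated by variables only if it is
  one of them.\<close>

lemma colon_eq_lq_set:
  fixes f :: "('n, 'k::field) mpoly"
  assumes "distinct us" "us = vs @ u # ws" "linear_quotients TYPE('k) us"
  shows "xmon u * f \<in> mon_gen (set vs) \<longleftrightarrow> f \<in> mon_gen (xvar ` lq_set TYPE('k) us u)"
proof (cases "vs = []")
  \<comment> \<open>\<open>linear_quotients\<close> says nothing about the first generator. There
    the colon ideal is 0 : u = 0, since multiplication by u is injective, and \<open>lq_set\<close>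
    is empty.\<close>
  case True
  have "mon_gen {} = {0 :: ('n, 'k) mpoly}" by (auto simp: mon_gen_iff)
  moreover have "xmon u * g = 0 \<longleftrightarrow> g = 0" for g :: "('n, 'k) mpoly"
    using keys_xmon_mult[of u g] by (metis image_is_empty keys_eq_empty)
  moreover have "xmon w \<noteq> (0 :: ('n, 'k) mpoly)" for w
    by (metis lookup_single_eq lookup_zero one_neq_zero xmon_def)
  moreover have "lq_set TYPE('k) us u = {}"
    using mem_lq_set_iff[OF assms(1,2), where 'k = 'k] calculation True
    by (metis xmon_add empty_iff equals0I list.set(1) singletonD)
  ultimately show ?thesis using True by simp
next
  case False
  have "1 \<le> length vs \<and> length vs < length us" using False assms(2) by (auto simp: Suc_le_eq)
  from assms(3)[unfolded linear_quotients_def, rule_format, OF this]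
  obtain A where "colon (mon_gen (set (take (length vs) us)) :: ('n, 'k) mpoly set) (xmon (us ! length vs)) =
      mon_gen (xvar ` A)" ..
  moreover have "take (length vs) us = vs" "us ! length vs = u" using assms(2) by auto
  ultimately have A: "colon (mon_gen (set vs) :: ('n, 'k) mpoly set) (xmon u) = mon_gen (xvar ` A)"
    by (simp only:)
  have "s \<in> lq_set TYPE('k) us u \<longleftrightarrow> s \<in> A" for s
  proof -
    have "s \<in> lq_set TYPE('k) us u \<longleftrightarrow> (xmon (xvar s) :: ('n, 'k) mpoly) \<in> mon_gen (xvar ` A)"
      unfolding mem_lq_set_iff[OF assms(1,2), where 'k = 'k] A[symmetric] colon_def by simp
    also have "\<dots> \<longleftrightarrow> s \<in> A"
      unfolding xmon_mem_mon_gen by (auto simp: mdvd_xvar_iff lookup_single when_def split: if_splits)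
    finally show ?thesis .
  qed
  then have "lq_set TYPE('k) us u = A" by blast
  moreover have "xmon u * f \<in> mon_gen (set vs) \<longleftrightarrow> f \<in> mon_gen (xvar ` A)"
    unfolding A[symmetric] colon_def mem_Collect_eq by (simp only: mult.commute)
  ultimately show ?thesis by (simp only:)
qed

text \<open>Let g be the value of \<open>decomp\<close> at x_t u. As x_t u lies in the ideal of the
  earlier generators, g is one of them. Since x_l divides x_t u / g, the monomial g divides x_t u /
  x_l, which is (u / x_l) x_t.\<close>

lemma nice_lift_index_mem:
  assumes "distinct us" "us = vs @ u # ws" "nice_lift_index TYPE('k::field) us u j"
    and t: "t \<in> lq_set TYPE('k) us u"
  shows "(xmon (u - xvar j + xvar t) :: ('n, 'k) mpoly) \<in> mon_gen (set vs)"
proof -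
  let ?w = "xvar t + u" and ?P = "\<lambda>i. i < length us \<and> mdvd (us ! i) (xvar t + u)"
  have j: "mdvd (xvar j) u" using assms(3) by (simp add: nice_lift_index_def supp_def)
  have "(xmon ?w :: ('n, 'k) mpoly) \<in> mon_gen (set vs)"
    using t mem_lq_set_iff[OF assms(1,2), where 'k = 'k] by (simp only: xmon_add)
  then obtain v where v: "v \<in> set vs" "mdvd v ?w" unfolding xmon_mem_mon_gen by blast
  then obtain i where i: "i < length vs" "vs ! i = v" by (auto simp: in_set_conv_nth)
  then have "?P i" using v(2) assms(2) by (simp add: nth_append)
  \<comment> \<open>The least index of a divisor is at most i, hence lies before the position of
    u.\<close>
  then have P: "?P (LEAST i. ?P i)" and "(LEAST i. ?P i) \<le> i" by (rule LeastI, rule Least_le)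
  then have "decomp us ?w = vs ! (LEAST i. ?P i)" and l: "(LEAST i. ?P i) < length vs"
    using i(1) assms(2) unfolding decomp_def by (auto simp: nth_append)
  then have g: "decomp us ?w \<in> set vs" "mdvd (decomp us ?w) ?w"
    using P nth_mem[OF l] unfolding decomp_def by auto
  have "mdvd (xvar j) (?w - decomp us ?w)" using assms(3) t by (simp add: nice_lift_index_def)
  then obtain v' where "?w - decomp us ?w = xvar j + v'" unfolding mdvd_def by blast
  then have "xvar j + (decomp us ?w + v') = ?w"
    using mdvd_add_diff[OF g(2)] by (metis add.left_commute)
  also have "?w = xvar j + (u - xvar j + xvar t)"
    using mdvd_add_diff[OF j] by (metis add.assoc add.commute)
  finally have "decomp us ?w + v' = u - xvar j + xvar t" by (rule add_left_imp_eq)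
  then have "mdvd (decomp us ?w) (u - xvar j + xvar t)" unfolding mdvd_def by metis
  then show ?thesis unfolding xmon_mem_mon_gen using g(1) by blast
qed

section \<open>Chains over S as a vector space over the constants\<close>

lemma const_hom: "const 1 = 1" "const (a + b) = const a + const b" "const (a * b) = const a * const b"
  by (simp_all add: const_def single_add mult_single)

lemma kscale_one [simp]: "kscale 1 a = a"
  by (rule ext) (simp add: kscale_def)

lemma vector_space_kscale_const:
  "Vector_Spaces.vector_space (\<lambda>c a. kscale (const c :: ('n, 'k::field) mpoly) a)"
proof
  fix a b :: "'a set \<Rightarrow> ('n, 'k) mpoly" and c d :: 'k
  show "kscale (const c) (a + b) = kscale (const c) a + kscale (const c) b" by (rule kscale_add)
  show "kscale (const (c + d)) a = kscale (const c) a + kscale (const d) a"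
    unfolding const_hom by (rule kscale_add_left)
  show "kscale (const c) (kscale (const d) a) = kscale (const (c * d)) a"
    unfolding const_hom by (rule kscale_kscale)
  show "kscale (const 1) a = a" unfolding const_hom by (rule kscale_one)
qed

theorem theorem6p3:
  fixes I :: "('n::{finite,linorder}, 'k::field) mpoly set"
    and us :: "'n mon list"
    and l :: "'n mon \<Rightarrow> 'n"
    and i :: nat
  assumes "monomial_ideal I"
    and "I \<subseteq> max_ideal \<cdot>\<^bsub>mpoly_ring\<^esub> max_ideal"
    and "distinct us" and "minimal_monomial_generators I (set us)"
    and "linear_quotients TYPE('k) us" and "sorted (map mdeg us)"
    and "regular_decomp TYPE('k) us"
    and "nice_koszul_lifts TYPE('k) us"
    and "\<forall>u \<in> set us. nice_lift_index TYPE('k) us u (l u)"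
    and "i \<ge> 1"
  shows
    "let Idx = {(u, \<sigma>). u \<in> set us \<and> \<sigma> \<subseteq> lq_set TYPE('k) us u \<and> card \<sigma> = i - 1};
         cyc = (\<lambda>(u, \<sigma>). lift_cycle I u (l u) \<sigma>);
         cls = koszul_class (qring I) (qvar I) i;
         H = koszul_homology (qring I) (\<lambda>c. bar I (const c)) (qvar I) i
     in cyc ` Idx \<subseteq> koszul_cycles (qring I) (qvar I) i
        \<and> inj_on (\<lambda>p. cls (cyc p)) Idx
        \<and> vectorspace field_ring H
        \<and> vectorspace.basis field_ring H ((\<lambda>p. cls (cyc p)) ` Idx)"
proof -
  define A where "A = lq_set TYPE('k) us"
  \<comment> \<open>k is the size of the sets \<sigma>; the lifted cycles have one degree
    more.\<close>
  obtain k where k: "i = Suc k" using assms(10) by (cases i) auto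
  have I: "I = mon_gen (set us)" using assms(4) by (simp add: minimal_monomial_generators_def)
  have e: "us = us @ []" by simp
  \<comment> \<open>Linear quotients enter through \<open>colon_eq_lq_set\<close>, the choice of l
    through \<open>nice_lift_index_mem\<close>.\<close>
  interpret L: linear_quotient_lifts us l A
  proof
    show "mdvd (xvar (l u)) u" if "u \<in> set us" for u
      using assms(9) that by (auto simp: nice_lift_index_def supp_def)
    show "(xmon u * f \<in> mon_gen (set vs)) = (f \<in> mon_gen (xvar ` A u))"
      if "us = vs @ u # ws" for vs u ws and f :: "('n, 'k) mpoly"
      unfolding A_def by (rule colon_eq_lq_set[OF assms(3) that assms(5)])
    show "(xmon (u - xvar (l u) + xvar t) :: ('n, 'k) mpoly) \<in> mon_gen (set vs)"
      if "us = vs @ u # ws" "t \<in> A u" for vs u ws t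
    proof (rule nice_lift_index_mem[OF assms(3) that(1)])
      show "nice_lift_index TYPE('k) us u (l u)" using assms(9) that(1) by simp
    qed (use that(2) in \<open>simp add: A_def\<close>)
  qed (rule assms(3))
  define Idx where "Idx = {(u, \<sigma>). u \<in> set us \<and> \<sigma> \<subseteq> lq_set TYPE('k) us u \<and> card \<sigma> = i - 1}"
  define H where "H = koszul_homology (qring I) (\<lambda>c. bar I (const c)) (qvar I) i"
  define z where "z = (\<lambda>(u, \<sigma>). klift u (l u) \<sigma> :: 'n set \<Rightarrow> ('n, 'k) mpoly)"
  let ?s = "\<lambda>c. kscale (const c) :: ('n set \<Rightarrow> ('n, 'k) mpoly) \<Rightarrow> _"
  have Idx: "Idx = Sigma (set us) (\<lambda>u. {\<sigma>. \<sigma> \<subseteq> A u \<and> card \<sigma> = k})"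
    by (auto simp: Idx_def A_def k)
  have cyc: "(\<lambda>(u, \<sigma>). lift_cycle I u (l u) \<sigma>) = (\<lambda>p. kbar I (z p))"
    by (auto simp: z_def lift_cycle_eq_kbar[OF I] fun_eq_iff)
  \<comment> \<open>The double sum over generators and subsets becomes a single sum over
    \<open>Idx\<close>, the form that \<open>basis_image\<close> expects.\<close>
  have sums: "(\<Sum>p\<in>Idx. ?s (c p) (z p)) = L.liftsum k (set us) (\<lambda>u \<sigma>. c (u, \<sigma>))" for c
    unfolding Idx z_def L.liftsum_def by (subst sum.Sigma) (auto intro!: sum.cong)
  have zV: "z p \<in> qcycles I i" if "p \<in> Idx" for p
    using that L.klift_mem_qcycles[OF e] unfolding Idx z_def I k by auto
  have V: "0 \<in> qcycles I i" "\<And>a b. a \<in> qcycles I i \<Longrightarrow> b \<in> qcycles I i \<Longrightarrow> a + b \<in> qcycles I i"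
      "\<And>c a. a \<in> qcycles I i \<Longrightarrow> ?s c a \<in> qcycles I i"
    unfolding qcycles_def I mem_Collect_eq kdiff_add kdiff_kscale kdiff_zero
    by (blast intro: kchains_zero kchains_add kchains_kscale coeffs_in_zero coeffs_in_add coeffs_in_kscale)+
  have carrier: "carrier H = kclass I i ` qcycles I i"
    by (simp add: H_def koszul_homology_def koszul_cycles_eq[OF I] image_image kclass_def[OF I])
  have zero: "\<zero>\<^bsub>H\<^esub> = kclass I i 0"
    by (simp add: H_def koszul_homology_def kclass_zero[OF I, symmetric])
  have add: "kclass I i a \<oplus>\<^bsub>H\<^esub> kclass I i b = kclass I i (a + b)"
    if "a \<in> qcycles I i" "b \<in> qcycles I i" for a b
    unfolding kclass_add[OF I, symmetric] by (simp add: H_def koszul_homology_def)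
  have smult: "c \<odot>\<^bsub>H\<^esub> kclass I i a = kclass I i (?s c a)"
    if "a \<in> qcycles I i" for c a
    unfolding kclass_kscale[OF I, symmetric] by (simp add: H_def koszul_homology_def)
  have span: "\<exists>c. kclass I i a = kclass I i (\<Sum>p\<in>Idx. ?s (c p) (z p))" if a: "a \<in> qcycles I i" for a
  proof -
    obtain d where "a - L.liftsum k (set us) d \<in> qbounds I i"
      using L.liftsum_spans[OF e] a unfolding I k by blast
    then have "kclass I i a = kclass I i (\<Sum>p\<in>Idx. ?s (case_prod d p) (z p))"
      unfolding sums by (simp add: kclass_eq_iff[OF I])
    then show ?thesis by (rule exI[of _ "case_prod d"])
  qed
  have indep: "\<forall>p\<in>Idx. c p = 0" if "kclass I i (\<Sum>p\<in>Idx. ?s (c p) (z p)) = kclass I i 0" for c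
  proof -
    have "L.liftsum k (set us) (\<lambda>u \<sigma>. c (u, \<sigma>)) \<in> qbounds (mon_gen (set us)) (Suc k)"
      using that unfolding kclass_eq_iff[OF I] sums diff_zero by (simp only: I k)
    from L.liftsum_independent[OF e this] show ?thesis unfolding Idx by auto
  qed
  have fin: "finite Idx" unfolding Idx by (intro finite_SigmaI) simp_all
  note hyps = vector_space_kscale_const V carrier zero add smult
  have "(\<lambda>p. kbar I (z p)) ` Idx \<subseteq> koszul_cycles (qring I) (qvar I) i"
    unfolding koszul_cycles_eq[OF I] using zV by blast
  moreover have "inj_on (\<lambda>p. kclass I i (z p)) Idx"
    by (rule basis_image(1)[where \<Phi> = "kclass I i" and z = z, OF hyps fin zV span indep])
  moreover have "vectorspace field_ring H" by (rule vectorspace_image[where \<Phi> = "kclass I i", OF hyps])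
  moreover have "vectorspace.basis field_ring H ((\<lambda>p. kclass I i (z p)) ` Idx)"
    by (rule basis_image(2)[where \<Phi> = "kclass I i" and z = z, OF hyps fin zV span indep])
  ultimately show ?thesis
    unfolding Let_def Idx_def[symmetric] H_def[symmetric] cyc kclass_def[OF I] by (intro conjI)
qed

end
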